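(* Let $0<\beta<1$. There is a positive constant $C$ such that for every $f\in C_B[0,\infty)$, every positive integer $n$ and every $x\in[0,\infty)$, $$|P_n^{\beta}(f,x)-f(x)|\le C\,\omega_2\!\left(f,\sqrt{\delta_n}\right)+\omega\!\left(f,\frac{\beta(2-\beta)}{n(1-\beta)}(1-e^{-nx})\right),$$ where $$\delta_n=\frac{2(1+2\beta-\beta^2)x}{n(1-\beta)}+(1-e^{-nx})\left[\frac{\beta^2(3-\beta)}{n^2(1-\beta)}-\frac{2\beta x(2-\beta)}{n(1-\beta)}\right]+\left(\frac{\beta(2-\beta)}{n(1-\beta)}(1-e^{-nx})\right)^2.$$
   Context: For $0\le\beta<1$, a positive integer $n$, an integer $k\ge 0$ and $x\in[0,\infty)$, let $$L_{n,k}^{(\beta)}(x)=\frac{nx(nx+k\beta)^{k-1}}{k!}\,e^{-(nx+k\beta)},$$ where for $k=0$ this is understood as $L_{n,0}^{(\beta)}(x)=e^{-nx}$. Write $\langle f,g\rangle=\int_0^\infty f(t)g(t)\,dt$. The generalized Phillips type operators are $$P_n^{\beta}(f,x)=\sum_{k=1}^{\infty}\frac{\langle L_{n,k-1}^{(\beta)}(t),f(t)\rangle}{\langle L_{n,k-1}^{(\beta)}(t),1\rangle}\,L_{n,k}^{(\beta)}(x)+e^{-nx}f(0),\qquad x\in[0,\infty).$$ $C_B[0,\infty)$ is the class of real-valued continuous bounded functions on $[0,\infty)$, with the norm $\|f\|=\sup_{x\in[0,\infty)}|f(x)|$. For $f\in C_B[0,\infty)$ and $\delta>0$, the $m$-th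 order modulus of continuity is $$\omega_m(f,\delta)=\sup_{0\le h\le\delta}\ \sup_{x\in[0,\infty)}|\Delta_h^m f(x)|,$$ where $\Delta_h$ is the forward difference, $\Delta_hf(x)=f(x+h)-f(x)$, and $\Delta_h^m$ is its $m$-th iterate; $\omega(f,\delta)=\omega_1(f,\delta)$. For $\delta=0$ the same formula is used (giving $0$). *)

theory Defs
  imports "HOL-Analysis.Analysis"
begin

definition phillips_basis :: "real \<Rightarrow> nat \<Rightarrow> nat \<Rightarrow> real \<Rightarrow> real" where
  "phillips_basis \<beta> n k x =
     (if k = 0 then exp (- (real n * x))
      else real n * x * (real n * x + real k * \<beta>) ^ (k - 1) / fact k
           * exp (- (real n * x + real k * \<beta>)))"

definition pairing :: "(real \<Rightarrow> real) \<Rightarrow> (real \<Rightarrow> real) \<Rightarrow> real" where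
  "pairing f g = (LBINT t:{0..}. f t * g t)"

(* The summation index is shifted by one: the summand at k here is the one that carries
   the basis function of index k + 1 outside the integral. *)
definition phillips_op :: "real \<Rightarrow> nat \<Rightarrow> (real \<Rightarrow> real) \<Rightarrow> real \<Rightarrow> real" where
  "phillips_op \<beta> n f x =
     (\<Sum>k. pairing (phillips_basis \<beta> n k) f / pairing (phillips_basis \<beta> n k) (\<lambda>_. 1)
           * phillips_basis \<beta> n (Suc k) x)
     + exp (- (real n * x)) * f 0"

(* Functions on the half-line are represented by total functions; only their values on
   [0, \<infinity>) enter any of the notions of this theory. *)
definition CB :: "(real \<Rightarrow> real) set" where
  "CB = {f. continuous_on {0..} f \<and> bounded (f ` {0..})}"

definition fdiff :: "real \<Rightarrow> (real \<Rightarrow> real) \<Rightarrow> real \<Rightarrow> real" where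
  "fdiff h f = (\<lambda>x. f (x + h) - f x)"

(* For f in CB and \<delta> \<ge> 0 both suprema range over nonempty bounded sets of reals. *)
definition modulus :: "nat \<Rightarrow> (real \<Rightarrow> real) \<Rightarrow> real \<Rightarrow> real" where
  "modulus m f \<delta> = (SUP h\<in>{0..\<delta>}. SUP x\<in>{0..}. \<bar>(fdiff h ^^ m) f x\<bar>)"

definition phillips_shift :: "real \<Rightarrow> nat \<Rightarrow> real \<Rightarrow> real" where
  "phillips_shift \<beta> n x = \<beta> * (2 - \<beta>) / (real n * (1 - \<beta>)) * (1 - exp (- (real n * x)))"

(* Nonnegative for x \<ge> 0: the terms linear in x add up to
   2 x (1 + \<beta> (2 - \<beta>) exp (- n x)) / (n (1 - \<beta>)). *)
definition phillips_delta :: "real \<Rightarrow> nat \<Rightarrow> real \<Rightarrow> real" where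
  "phillips_delta \<beta> n x =
     2 * (1 + 2 * \<beta> - \<beta>\<^sup>2) * x / (real n * (1 - \<beta>))
     + (1 - exp (- (real n * x)))
       * (\<beta>\<^sup>2 * (3 - \<beta>) / ((real n)\<^sup>2 * (1 - \<beta>))
          - 2 * \<beta> * x * (2 - \<beta>) / (real n * (1 - \<beta>)))
     + (phillips_shift \<beta> n x)\<^sup>2"

end

theory Submission
  imports Defs
begin

text \<open>
  With \<open>y = n x\<close>, the basis functions are the weights \<open>W\<^sub>k(y)\<close> of Jain's generalised Poisson
  distribution, and \<open>W\<^sub>k' = W\<^sub>k\<^sub>-\<^sub>1(\<cdot> + \<beta>) - W\<^sub>k\<close>. Comparing solutions of such equations bounds the
  partial sums of \<open>W\<^sub>k\<close>, \<open>k W\<^sub>k\<close> and \<open>k\<^sup>2 W\<^sub>k\<close>, which gives total mass \<open>1\<close>, mean \<open>y / (1 - \<beta>)\<close>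
  and variance at most \<open>y / (1 - \<beta>)\<^sup>3\<close>. The operator is thus the expectation of \<open>f\<close> under a
  probability measure. Its kernels have incomplete gamma integrals as moments, so the mean \<open>\<mu>\<close>
  is not exactly \<open>x\<close> plus the shift of the theorem, but it satisfies \<open>x \<le> \<mu> \<le> x + shift\<close>; this
  is enough for the term \<open>\<omega>(f, shift)\<close>. The second moment about \<open>x\<close> is at most a multiple of
  \<open>\<delta>\<^sub>n \<ge> 2 x / (n (1 - \<beta>))\<close>.

  For \<open>h > 0\<close> a function \<open>f\<close> differs from a suitable affine function \<open>\<ell>\<close> by at most
  \<open>\<omega>\<^sub>2(f, h) (32 + 2 ((t - x) / h)\<^sup>2)\<close>: take the chord over an interval of length \<open>2 h\<close> containing
  \<open>x\<close>, and let second differences control the growth outside. Since the operator maps \<open>\<ell>\<close> to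
  \<open>\<ell>(\<mu>)\<close>, integrating this bound with \<open>h = sqrt \<delta>\<^sub>n\<close> finishes the proof.
\<close>

section \<open>Jain's weights\<close>

text \<open>The case \<open>k = 0\<close> is separate because truncated subtraction would turn the
  general formula into \<open>y * exp (- y)\<close>.\<close>

definition jain_weight :: "real \<Rightarrow> nat \<Rightarrow> real \<Rightarrow> real" where
  "jain_weight \<beta> k y =
     (if k = 0 then exp (- y)
      else y * (y + real k * \<beta>) ^ (k - 1) / fact k * exp (- (y + real k * \<beta>)))"

lemma phillips_basis_eq: "phillips_basis \<beta> n k x = jain_weight \<beta> k (real n * x)"
  by (simp add: phillips_basis_def jain_weight_def)

lemma jain_weight_0 [simp]: "jain_weight \<beta> 0 y = exp (- y)"
  by (simp add: jain_weight_def)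

section \<open>Shift identity, derivatives and comparison of solutions\<close>

lemma jain_weight_Suc:
  "jain_weight \<beta> (Suc k) y =
     y * (y + real (Suc k) * \<beta>) ^ k / fact (Suc k) * exp (- (y + real (Suc k) * \<beta>))"
  by (simp add: jain_weight_def)

lemma jain_weight_at_0: "jain_weight \<beta> k 0 = (if k = 0 then 1 else 0)"
  by (simp add: jain_weight_def)

lemma jain_weight_nonneg: "0 \<le> \<beta> \<Longrightarrow> 0 \<le> y \<Longrightarrow> 0 \<le> jain_weight \<beta> k y"
  by (simp add: jain_weight_def)

text \<open>Stated without division, this links the weight of index \<open>k\<close> at
  \<open>y + \<beta>\<close> to the power in the weight of index \<open>Suc k\<close> at
  \<open>y\<close>; both have the same base. It drives the recursion for the mean.\<close>

lemma jain_weight_shift: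
  "(y + \<beta>) * ((y + real (Suc k) * \<beta>) ^ k * exp (- (y + real (Suc k) * \<beta>)))
     = fact k * (y + real (Suc k) * \<beta>) * jain_weight \<beta> k (y + \<beta>)"
proof (cases k)
  case (Suc j)
  have e: "y + \<beta> + real (Suc j) * \<beta> = y + real (Suc k) * \<beta>"
    using Suc by (simp add: algebra_simps)
  show ?thesis unfolding Suc jain_weight_Suc e[unfolded Suc] by simp
qed (simp add: algebra_simps)

lemma DERIV_jain_weight_Suc:
  assumes "0 \<le> \<beta>" "0 \<le> y"
  shows "(jain_weight \<beta> (Suc k) has_real_derivative
           jain_weight \<beta> k (y + \<beta>) - jain_weight \<beta> (Suc k) y) (at y)"
proof (cases k)
  case 0
  show ?thesis unfolding jain_weight_Suc 0
    by (rule derivative_eq_intros refl | simp add: algebra_simps)+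
next
  case (Suc j)
  define s where "s = y + real (Suc k) * \<beta>"
  have e: "y + \<beta> + real (Suc j) * \<beta> = s"
    using Suc by (simp add: s_def algebra_simps)
  have W: "jain_weight \<beta> k (y + \<beta>) = (y + \<beta>) * s ^ j / fact k * exp (- s)"
    unfolding Suc jain_weight_Suc e by simp
  have "((\<lambda>y. (y * (y + real (Suc k) * \<beta>) ^ k) * (exp (- (y + real (Suc k) * \<beta>)) / fact (Suc k)))
      has_real_derivative
      (s ^ k + y * (real k * s ^ j)) * (exp (- s) / fact (Suc k))
        - y * s ^ k * (exp (- s) / fact (Suc k))) (at y)"
    unfolding s_def
    by (rule derivative_eq_intros refl | simp add: Suc del: of_nat_Suc fact_Suc)+
      (simp add: algebra_simps del: of_nat_Suc fact_Suc)
  then have d: "(jain_weight \<beta> (Suc k) has_real_derivative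
      (s ^ k + y * (real k * s ^ j)) / fact (Suc k) * exp (- s)
        - y * s ^ k / fact (Suc k) * exp (- s)) (at y)"
    unfolding jain_weight_Suc by (simp add: add_divide_distrib diff_divide_distrib algebra_simps del: of_nat_Suc fact_Suc)
  \<comment> \<open>Since \<open>s + k * y = (k + 1) * (y + \<beta>)\<close>, the product rule
    produces the preceding weight at the shifted argument.\<close>
  have "s ^ k + y * (real k * s ^ j) = real (Suc k) * ((y + \<beta>) * s ^ j)"
    using Suc by (simp add: s_def algebra_simps)
  then have "(s ^ k + y * (real k * s ^ j)) / fact (Suc k) = (y + \<beta>) * s ^ j / fact k"
    by (simp add: field_simps del: of_nat_Suc)
  then show ?thesis using d unfolding W by (simp add: jain_weight_Suc s_def)
qed

lemma sum_jain_weight_at_0: "(\<Sum>k\<le>K. c k * jain_weight \<beta> k 0) = c 0"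
  by (simp add: jain_weight_at_0 if_distrib [of "(*) _"] cong: if_cong)

text \<open>The weight of index \<open>0\<close> contributes no shifted term, so the shifted sum has
  one term fewer. A bound for \<open>K\<close> therefore controls the equation for
  \<open>Suc K\<close>, which enables induction on \<open>K\<close>.\<close>

lemma DERIV_sum_jain_weight:
  assumes "0 \<le> \<beta>" "0 \<le> y"
  shows "((\<lambda>y. \<Sum>k\<le>K. c k * jain_weight \<beta> k y) has_real_derivative
           (\<Sum>k<K. c (Suc k) * jain_weight \<beta> k (y + \<beta>)) - (\<Sum>k\<le>K. c k * jain_weight \<beta> k y)) (at y)"
proof (induction K)
  case 0
  show ?case by (auto intro!: derivative_eq_intros)
next
  case (Suc K)
  have "((\<lambda>y. (\<Sum>k\<le>K. c k * jain_weight \<beta> k y) + c (Suc K) * jain_weight \<beta> (Suc K) y)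
      has_real_derivative
      ((\<Sum>k<K. c (Suc k) * jain_weight \<beta> k (y + \<beta>)) - (\<Sum>k\<le>K. c k * jain_weight \<beta> k y))
      + c (Suc K) * (jain_weight \<beta> K (y + \<beta>) - jain_weight \<beta> (Suc K) y)) (at y)"
    by (intro DERIV_add Suc.IH DERIV_cmult DERIV_jain_weight_Suc assms)
  then show ?case by (simp add: algebra_simps)
qed

text \<open>With the integrating factor \<open>exp y\<close>, the derivative of
  \<open>exp y * (G y - g y)\<close> is \<open>exp y * (G' y - g' y)\<close>. Here \<open>g'\<close>
  and \<open>G'\<close> are the inhomogeneous terms of the equations, not derivatives.\<close>

lemma exp_weighted_comparison:
  fixes g G g' G' :: "real \<Rightarrow> real"
  assumes g: "\<And>y. 0 \<le> y \<Longrightarrow> (g has_real_derivative g' y - g y) (at y)"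
    and G: "\<And>y. 0 \<le> y \<Longrightarrow> (G has_real_derivative G' y - G y) (at y)"
    and le: "\<And>y. 0 \<le> y \<Longrightarrow> g' y \<le> G' y" and le0: "g 0 \<le> G 0" and "0 \<le> y"
  shows "g y \<le> G y"
proof -
  have "exp 0 * (G 0 - g 0) \<le> exp y * (G y - g y)"
  proof (rule DERIV_nonneg_imp_nondecreasing [OF \<open>0 \<le> y\<close>])
    fix z :: real assume z: "0 \<le> z" "z \<le> y"
    have "((\<lambda>y. exp y * (G y - g y)) has_real_derivative exp z * (G' z - g' z)) (at z)"
      by (auto intro!: derivative_eq_intros g G z simp: algebra_simps)
    then show "\<exists>d. ((\<lambda>y. exp y * (G y - g y)) has_real_derivative d) (at z) \<and> 0 \<le> d"
      using le[OF z(1)] by (intro exI conjI) auto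
  qed
  then have "0 \<le> exp y * (G y - g y)" using le0 by simp
  then show ?thesis by (simp add: zero_le_mult_iff not_less)
qed

section \<open>Bounds for partial sums of the mass, mean and second moment\<close>

context
  fixes \<beta> :: real
  assumes \<beta>: "0 < \<beta>" "\<beta> < 1"
begin

text \<open>The sum up to \<open>Suc K\<close> solves an equation whose inhomogeneous term is a sum
  up to \<open>K\<close> at \<open>y + \<beta>\<close>; \<open>step\<close> compares that term with
  \<open>B'\<close>. For \<open>K = 0\<close> the term is \<open>0\<close>, whence
  \<open>0 \<le> B' y\<close>.\<close>

lemma sum_jain_weight_le:
  fixes c :: "nat \<Rightarrow> real" and B B' :: "real \<Rightarrow> real"
  assumes B: "\<And>y. 0 \<le> y \<Longrightarrow> (B has_real_derivative B' y - B y) (at y)" and B0: "c 0 \<le> B 0"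
    and step: "\<And>y K. 0 \<le> y \<Longrightarrow> (\<Sum>k\<le>K. c k * jain_weight \<beta> k (y + \<beta>)) \<le> B (y + \<beta>)
      \<Longrightarrow> (\<Sum>k\<le>K. c (Suc k) * jain_weight \<beta> k (y + \<beta>)) \<le> B' y"
    and B'0: "\<And>y. 0 \<le> y \<Longrightarrow> 0 \<le> B' y"
  shows "0 \<le> y \<Longrightarrow> (\<Sum>k\<le>K. c k * jain_weight \<beta> k y) \<le> B y"
proof (induction K arbitrary: y)
  case 0
  show ?case
    by (rule exp_weighted_comparison [where G = B and g' = "\<lambda>_. 0" and G' = B' and
          g = "\<lambda>y. \<Sum>k\<le>0. c k * jain_weight \<beta> k y"])
       (use DERIV_sum_jain_weight[of \<beta> _ c 0] \<beta> B B0 B'0 0 in auto)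
next
  case (Suc K)
  show ?case
  proof (rule exp_weighted_comparison [OF DERIV_sum_jain_weight[of \<beta> _ c "Suc K"] B])
    fix z :: real assume z: "0 \<le> z"
    show "(\<Sum>k<Suc K. c (Suc k) * jain_weight \<beta> k (z + \<beta>)) \<le> B' z"
      unfolding lessThan_Suc_atMost using \<beta> z by (intro step Suc.IH) auto
  qed (use \<beta> B0 Suc.prems in \<open>auto simp: sum_jain_weight_at_0 simp del: sum.atMost_Suc\<close>)
qed

lemma sum_jain_weight_le_1:
  assumes "0 \<le> y" shows "(\<Sum>k\<le>K. jain_weight \<beta> k y) \<le> 1"
  using sum_jain_weight_le[of "\<lambda>_. 1" "\<lambda>_. 1" "\<lambda>_. 1" y K] assms by simp

text \<open>The bound reproduces itself:
  \<open>(y + \<beta>) / (1 - \<beta>) + 1 = (y + 1) / (1 - \<beta>)\<close>, which is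
  \<open>y / (1 - \<beta>)\<close> plus its derivative.\<close>

lemma sum_jain_weight_mean_le:
  assumes "0 \<le> y" shows "(\<Sum>k\<le>K. real k * jain_weight \<beta> k y) \<le> y / (1 - \<beta>)"
proof (rule sum_jain_weight_le [where B' = "\<lambda>y. (y + 1) / (1 - \<beta>)"])
  fix y :: real and K assume y: "0 \<le> y"
    and *: "(\<Sum>k\<le>K. real k * jain_weight \<beta> k (y + \<beta>)) \<le> (y + \<beta>) / (1 - \<beta>)"
  have "(\<Sum>k\<le>K. real (Suc k) * jain_weight \<beta> k (y + \<beta>)) \<le> (y + \<beta>) / (1 - \<beta>) + 1"
    using * sum_jain_weight_le_1[of "y + \<beta>" K] y \<beta> by (simp add: algebra_simps sum.distrib)
  then show "(\<Sum>k\<le>K. real (Suc k) * jain_weight \<beta> k (y + \<beta>)) \<le> (y + 1) / (1 - \<beta>)"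
    using \<beta> by (simp add: field_simps)
next
  fix y :: real assume "0 \<le> y"
  show "((\<lambda>y. y / (1 - \<beta>)) has_real_derivative (y + 1) / (1 - \<beta>) - y / (1 - \<beta>)) (at y)"
    by (simp add: diff_divide_distrib [symmetric] DERIV_cdivide [OF DERIV_ident])
qed (use \<beta> assms in auto)

text \<open>Expanding \<open>(k + 1)\<^sup>2\<close> brings in the mass and the mean. The polynomial
  is chosen so that the resulting bound at \<open>y + \<beta>\<close> equals the polynomial plus its
  derivative at \<open>y\<close>.\<close>

lemma sum_jain_weight_square_le:
  assumes "0 \<le> y"
  shows "(\<Sum>k\<le>K. (real k)\<^sup>2 * jain_weight \<beta> k y) \<le> (y / (1 - \<beta>))\<^sup>2 + y / (1 - \<beta>) ^ 3"
proof (rule sum_jain_weight_le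
    [where B' = "\<lambda>y. (y / (1 - \<beta>))\<^sup>2 + y / (1 - \<beta>) ^ 3 + 2 * y / (1 - \<beta>)\<^sup>2 + 1 / (1 - \<beta>) ^ 3"])
  fix y :: real and K assume y: "0 \<le> y"
    and *: "(\<Sum>k\<le>K. (real k)\<^sup>2 * jain_weight \<beta> k (y + \<beta>))
      \<le> ((y + \<beta>) / (1 - \<beta>))\<^sup>2 + (y + \<beta>) / (1 - \<beta>) ^ 3"
  have "(\<Sum>k\<le>K. (real (Suc k))\<^sup>2 * jain_weight \<beta> k (y + \<beta>))
      = (\<Sum>k\<le>K. (real k)\<^sup>2 * jain_weight \<beta> k (y + \<beta>))
        + 2 * (\<Sum>k\<le>K. real k * jain_weight \<beta> k (y + \<beta>)) + (\<Sum>k\<le>K. jain_weight \<beta> k (y + \<beta>))"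
    by (simp add: algebra_simps power2_eq_square sum.distrib sum_distrib_left)
  also have "\<dots> \<le> ((y + \<beta>) / (1 - \<beta>))\<^sup>2 + (y + \<beta>) / (1 - \<beta>) ^ 3 + 2 * ((y + \<beta>) / (1 - \<beta>)) + 1"
    using * sum_jain_weight_le_1[of "y + \<beta>" K] sum_jain_weight_mean_le[of "y + \<beta>" K] y \<beta>
    by linarith
  also have "\<dots> = (y / (1 - \<beta>))\<^sup>2 + y / (1 - \<beta>) ^ 3 + 2 * y / (1 - \<beta>)\<^sup>2 + 1 / (1 - \<beta>) ^ 3"
  proof -
    \<comment> \<open>The relation \<open>r * \<beta> = r - 1\<close> makes the identity polynomial
      in \<open>y\<close> and \<open>r\<close>.\<close>
    define r where "r = 1 / (1 - \<beta>)"
    have r: "r * \<beta> = r - 1" "\<And>a. a / (1 - \<beta>) = a * r"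
      using \<beta> by (auto simp: r_def field_simps)
    have r2: "\<And>a. a / (1 - \<beta>)^2 = a * r^2" "\<And>a. a / (1 - \<beta>)^3 = a * r^3"
      by (auto simp: r_def power_one_over)
    have b: "\<beta> * r = r - 1" using r by (simp add: mult.commute)
    have 1: "(y + \<beta>) * r = y * r + (r - 1)" using b by (simp add: algebra_simps)
    have 2: "(y + \<beta>) * r ^ 3 = y * r^3 + (r - 1) * r^2"
      unfolding power3_eq_cube power2_eq_square using b by (simp add: distrib_right mult.assoc [symmetric])
    show ?thesis unfolding r r2 1 2 by (simp add: power2_eq_square power3_eq_cube algebra_simps)
  qed
  finally show "(\<Sum>k\<le>K. (real (Suc k))\<^sup>2 * jain_weight \<beta> k (y + \<beta>)) \<le> \<dots>" .
next
  fix y :: real assume "0 \<le> y"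
  have "((\<lambda>y. y\<^sup>2 / (1 - \<beta>)\<^sup>2 + y / (1 - \<beta>) ^ 3) has_real_derivative
      2 * y / (1 - \<beta>)\<^sup>2 + 1 / (1 - \<beta>) ^ 3) (at y)"
    by (intro DERIV_add DERIV_cdivide DERIV_ident) (auto intro!: derivative_eq_intros)
  then show "((\<lambda>y. (y / (1 - \<beta>))\<^sup>2 + y / (1 - \<beta>) ^ 3) has_real_derivative
      (y / (1 - \<beta>))\<^sup>2 + y / (1 - \<beta>) ^ 3 + 2 * y / (1 - \<beta>)\<^sup>2 + 1 / (1 - \<beta>) ^ 3
      - ((y / (1 - \<beta>))\<^sup>2 + y / (1 - \<beta>) ^ 3)) (at y)"
    by (simp add: power_divide)
qed (use \<beta> assms in auto)

text \<open>In the differential inequality of the induction step, the induction hypothesis suffices for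
  small \<open>y\<close>; exactly where it no longer does, the required lower bound is not positive.\<close>
lemma sum_jain_weight_ge:
  "0 \<le> y \<Longrightarrow> 1 - y / ((1 - \<beta>) * (real K + 1)) \<le> (\<Sum>k\<le>K. 1 * jain_weight \<beta> k y)"
proof (induction K arbitrary: y)
  case 0
  have "1 - y / (1 - \<beta>) \<le> 1 - y" using \<beta> 0 by (simp add: field_simps mult_left_le)
  also have "\<dots> \<le> exp (- y)" using exp_ge_add_one_self[of "- y"] by simp
  finally show ?case by simp
next
  case (Suc K)
  define m where "m = real K + 2"
  show ?case
  proof (rule exp_weighted_comparison [where g = "\<lambda>y. 1 - y / ((1 - \<beta>) * (real (Suc K) + 1))"
        and g' = "\<lambda>y. 1 - (y + 1) / ((1 - \<beta>) * m)"
        and G = "\<lambda>y. \<Sum>k\<le>Suc K. 1 * jain_weight \<beta> k y"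
        and G' = "\<lambda>y. \<Sum>k<Suc K. 1 * jain_weight \<beta> k (y + \<beta>)"])
    fix z :: real assume z: "0 \<le> z"
    show "((\<lambda>y. 1 - y / ((1 - \<beta>) * (real (Suc K) + 1))) has_real_derivative
        1 - (z + 1) / ((1 - \<beta>) * m) - (1 - z / ((1 - \<beta>) * (real (Suc K) + 1)))) (at z)"
    proof -
      have "((\<lambda>y. 1 - y / ((1 - \<beta>) * m)) has_real_derivative 0 - 1 / ((1 - \<beta>) * m)) (at z)"
        by (intro DERIV_diff DERIV_const DERIV_cdivide DERIV_ident)
      then show ?thesis by (simp add: m_def add_divide_distrib add.commute)
    qed
    show "((\<lambda>y. \<Sum>k\<le>Suc K. 1 * jain_weight \<beta> k y) has_real_derivative
        (\<Sum>k<Suc K. 1 * jain_weight \<beta> k (z + \<beta>)) - (\<Sum>k\<le>Suc K. 1 * jain_weight \<beta> k z)) (at z)"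
      by (rule DERIV_sum_jain_weight) (use \<beta> z in auto)
    have nonneg: "0 \<le> (\<Sum>k<Suc K. 1 * jain_weight \<beta> k (z + \<beta>))"
      by (intro sum_nonneg) (use \<beta> z in \<open>auto simp: jain_weight_nonneg\<close>)
    have IH: "1 - (z + \<beta>) / ((1 - \<beta>) * (real K + 1)) \<le> (\<Sum>k<Suc K. 1 * jain_weight \<beta> k (z + \<beta>))"
      unfolding lessThan_Suc_atMost using \<beta> z by (intro Suc.IH) auto
    have m: "0 < (1 - \<beta>) * m" using \<beta> by (simp add: m_def)
    show "1 - (z + 1) / ((1 - \<beta>) * m) \<le> (\<Sum>k<Suc K. 1 * jain_weight \<beta> k (z + \<beta>))"
    proof (cases "z + 1 \<ge> (1 - \<beta>) * m")
      case True
      then have "1 \<le> (z + 1) / ((1 - \<beta>) * m)" using m by (simp only: le_divide_eq_1_pos)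
      then show ?thesis using nonneg by simp
    next
      case False
      \<comment> \<open>The right side minus the left side is
        \<open>(1 - \<beta>) * m - (z + 1)\<close>, positive in this case.\<close>
      have "(z + \<beta>) * m \<le> (z + 1) * (real K + 1)"
        using False by (simp add: m_def algebra_simps)
      then have "(z + \<beta>) / (real K + 1) \<le> (z + 1) / m"
        by (simp add: m_def divide_simps mult.commute)
      then have "(z + \<beta>) / (real K + 1) / (1 - \<beta>) \<le> (z + 1) / m / (1 - \<beta>)"
        using \<beta> by (intro divide_right_mono) auto
      then have "(z + \<beta>) / ((1 - \<beta>) * (real K + 1)) \<le> (z + 1) / ((1 - \<beta>) * m)"
        by (simp add: mult.commute)
      then show ?thesis using IH by simp
    qed
  qed (use \<beta> Suc.prems in \<open>auto simp: sum_jain_weight_at_0 [of "\<lambda>_. 1", simplified] simp del: sum.atMost_Suc\<close>)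
qed

section \<open>Exact mass and mean, and the variance bound\<close>

lemma jain_weight_sums:
  assumes y: "0 \<le> y" shows "(\<lambda>k. jain_weight \<beta> k y) sums 1"
proof -
  have "(\<lambda>K. \<Sum>k\<le>K. jain_weight \<beta> k y) \<longlonglongrightarrow> 1"
  proof (rule tendsto_sandwich)
    show "\<forall>\<^sub>F K in sequentially. 1 - y / (1 - \<beta>) * inverse (real (Suc K)) \<le> (\<Sum>k\<le>K. jain_weight \<beta> k y)"
      using sum_jain_weight_ge[OF y] by (intro always_eventually) (simp add: divide_inverse add.commute mult.assoc)
    show "\<forall>\<^sub>F K in sequentially. (\<Sum>k\<le>K. jain_weight \<beta> k y) \<le> 1"
      using sum_jain_weight_le_1[OF y] by simp
    show "(\<lambda>K. 1 - y / (1 - \<beta>) * inverse (real (Suc K))) \<longlonglongrightarrow> 1"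
      using tendsto_diff[OF tendsto_const[of 1] tendsto_mult_left[OF LIMSEQ_inverse_real_of_nat, of "y / (1 - \<beta>)"]]
      by simp
  qed simp
  then show ?thesis by (simp add: sums_def_le)
qed

lemma summable_bounded_jain:
  assumes y: "0 \<le> y" and c: "\<And>k. 0 \<le> c k" and B: "\<And>K. (\<Sum>k\<le>K. c k * jain_weight \<beta> k y) \<le> B"
  shows "summable (\<lambda>k. c k * jain_weight \<beta> k y)" "(\<Sum>k. c k * jain_weight \<beta> k y) \<le> B"
proof -
  have nn: "0 \<le> c k * jain_weight \<beta> k y" for k
    using c y \<beta> by (simp add: jain_weight_nonneg)
  show s: "summable (\<lambda>k. c k * jain_weight \<beta> k y)"
    by (rule bounded_imp_summable [OF nn B])
  have "(\<lambda>K. \<Sum>k\<le>K. c k * jain_weight \<beta> k y) \<longlonglongrightarrow> (\<Sum>k. c k * jain_weight \<beta> k y)"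
    using summable_sums[OF s] by (simp add: sums_def_le)
  then show "(\<Sum>k. c k * jain_weight \<beta> k y) \<le> B"
    by (rule LIMSEQ_le_const2) (use B in auto)
qed

text \<open>Partial sums give only an upper bound. The quotient \<open>M y / y\<close> satisfies a
  recursion with fixed point \<open>1 / (1 - \<beta>)\<close>; its distance from that point
  contracts by \<open>\<beta>\<close> at each shift and is bounded uniformly in \<open>y\<close>, so
  it is \<open>0\<close>.\<close>

lemma jain_weight_mean_sums:
  assumes y: "0 \<le> y"
  shows "(\<lambda>k. real k * jain_weight \<beta> k y) sums (y / (1 - \<beta>))"
proof -
  define M where "M y = (\<Sum>k. real k * jain_weight \<beta> k y)" for y
  have sm: "summable (\<lambda>k. real k * jain_weight \<beta> k y)" if "0 \<le> y" for y
    by (rule summable_bounded_jain(1) [OF that _ sum_jain_weight_mean_le [OF that]]) simp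
  have M_sums: "(\<lambda>k. real k * jain_weight \<beta> k y) sums M y" if "0 \<le> y" for y
    unfolding M_def using sm[OF that] by (rule summable_sums)
  have M_le: "M y \<le> y / (1 - \<beta>)" if "0 \<le> y" for y
    unfolding M_def by (rule summable_bounded_jain(2) [OF that _ sum_jain_weight_mean_le [OF that]]) simp
  have M_ge: "0 \<le> M y" if "0 \<le> y" for y
    unfolding M_def using sm[OF that] that \<beta> by (intro suminf_nonneg) (auto simp: jain_weight_nonneg)
  have rec: "M y / y = 1 + \<beta> * (M (y + \<beta>) / (y + \<beta>))" if y: "0 < y" for y
  proof -
    \<comment> \<open>Rewritten with weights at \<open>y + \<beta>\<close>, the terms of the mean
      involve only the mass and the mean at that point.\<close>
    have eq: "real (Suc k) * jain_weight \<beta> (Suc k) y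
       = y / (y + \<beta>) * ((y + \<beta>) * jain_weight \<beta> k (y + \<beta>) + \<beta> * (real k * jain_weight \<beta> k (y + \<beta>)))" for k
    proof -
      have "real (Suc k) * jain_weight \<beta> (Suc k) y
        = y / fact k * ((y + real (Suc k) * \<beta>) ^ k * exp (- (y + real (Suc k) * \<beta>)))"
        unfolding jain_weight_Suc by (simp del: of_nat_Suc)
      also have "(y + real (Suc k) * \<beta>) ^ k * exp (- (y + real (Suc k) * \<beta>))
        = fact k * (y + real (Suc k) * \<beta>) * jain_weight \<beta> k (y + \<beta>) / (y + \<beta>)"
        using jain_weight_shift[of y \<beta> k] y \<beta> by (simp add: field_simps)
      also have "y / fact k * (fact k * (y + real (Suc k) * \<beta>) * jain_weight \<beta> k (y + \<beta>) / (y + \<beta>))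
        = y / (y + \<beta>) * ((y + real (Suc k) * \<beta>) * jain_weight \<beta> k (y + \<beta>))"
        by simp
      also have "(y + real (Suc k) * \<beta>) * jain_weight \<beta> k (y + \<beta>)
        = (y + \<beta>) * jain_weight \<beta> k (y + \<beta>) + \<beta> * (real k * jain_weight \<beta> k (y + \<beta>))"
        by (simp add: algebra_simps)
      finally show ?thesis .
    qed
    have "(\<lambda>k. real (Suc k) * jain_weight \<beta> (Suc k) y) sums
        (y / (y + \<beta>) * ((y + \<beta>) * 1 + \<beta> * M (y + \<beta>)))"
      unfolding eq by (intro sums_mult sums_add jain_weight_sums M_sums) (use y \<beta> in auto)
    then have "(\<lambda>k. real k * jain_weight \<beta> k y) sums (y / (y + \<beta>) * ((y + \<beta>) * 1 + \<beta> * M (y + \<beta>)))"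
      using sums_Suc_iff[of "\<lambda>k. real k * jain_weight \<beta> k y"] by simp
    then have "M y = y / (y + \<beta>) * ((y + \<beta>) * 1 + \<beta> * M (y + \<beta>))"
      using M_sums[of y] y sums_unique2 by fastforce
    then show ?thesis using y \<beta> by (simp add: field_simps)
  qed
  have dist: "\<bar>1 / (1 - \<beta>) - M y / y\<bar> \<le> \<beta> ^ N * (1 / (1 - \<beta>))" if "0 < y" for y N
    using that
  proof (induction N arbitrary: y)
    case 0
    have "M y / y \<le> 1 / (1 - \<beta>)" "0 \<le> M y / y"
      using M_le[of y] M_ge[of y] 0 \<beta> by (auto simp: field_simps)
    then show ?case by simp
  next
    case (Suc N)
    have "1 / (1 - \<beta>) - M y / y = \<beta> * (1 / (1 - \<beta>) - M (y + \<beta>) / (y + \<beta>))"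
      unfolding rec[OF Suc.prems] using \<beta> by (simp add: field_simps)
    then have "\<bar>1 / (1 - \<beta>) - M y / y\<bar> = \<beta> * \<bar>1 / (1 - \<beta>) - M (y + \<beta>) / (y + \<beta>)\<bar>"
      using \<beta> by (simp only: abs_mult)
    also have "\<dots> \<le> \<beta> * (\<beta> ^ N * (1 / (1 - \<beta>)))"
      using \<beta> Suc.prems by (intro mult_left_mono Suc.IH) auto
    finally show ?case by simp
  qed
  have "M y = y / (1 - \<beta>)"
  proof (cases "y = 0")
    case True
    then show ?thesis using M_le[of 0] M_ge[of 0] by simp
  next
    case False
    have "(\<lambda>N. \<beta> ^ N * (1 / (1 - \<beta>))) \<longlonglongrightarrow> 0 * (1 / (1 - \<beta>))"
      using \<beta> by (intro tendsto_mult_right LIMSEQ_power_zero) auto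
    then have "\<bar>1 / (1 - \<beta>) - M y / y\<bar> \<le> 0 * (1 / (1 - \<beta>))"
      by (rule LIMSEQ_le_const) (use dist[of y] False y in auto)
    then have "M y / y = 1 / (1 - \<beta>)" by simp
    then show ?thesis using False by (simp add: field_simps)
  qed
  then show ?thesis using M_sums[OF y] by simp
qed

text \<open>The mean enters the expanded square with a negative sign, so its exact value is used;
  for the second moment an upper bound suffices.\<close>

lemma jain_weight_variance:
  assumes y: "0 \<le> y"
  shows "summable (\<lambda>k. (real k * (1 - \<beta>) - y)\<^sup>2 * jain_weight \<beta> k y)"
    and "(\<Sum>k. (real k * (1 - \<beta>) - y)\<^sup>2 * jain_weight \<beta> k y) \<le> y / (1 - \<beta>)"
proof -
  define Q where "Q = (\<Sum>k. (real k)\<^sup>2 * jain_weight \<beta> k y)"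
  note sq = summable_bounded_jain[OF y _ sum_jain_weight_square_le[OF y], simplified]
  have Q: "(\<lambda>k. (real k)\<^sup>2 * jain_weight \<beta> k y) sums Q"
    unfolding Q_def by (rule summable_sums) (rule sq)
  have eq: "(real k * (1 - \<beta>) - y)\<^sup>2 * jain_weight \<beta> k y
     = (1 - \<beta>)\<^sup>2 * ((real k)\<^sup>2 * jain_weight \<beta> k y)
       - 2 * y * (1 - \<beta>) * (real k * jain_weight \<beta> k y) + y\<^sup>2 * jain_weight \<beta> k y" for k
    by (simp add: power2_eq_square algebra_simps)
  have *: "(\<lambda>k. (real k * (1 - \<beta>) - y)\<^sup>2 * jain_weight \<beta> k y) sums
      ((1 - \<beta>)\<^sup>2 * Q - 2 * y * (1 - \<beta>) * (y / (1 - \<beta>)) + y\<^sup>2 * 1)"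
    unfolding eq
    by (intro sums_add sums_diff sums_mult Q jain_weight_sums jain_weight_mean_sums y)
  then show "summable (\<lambda>k. (real k * (1 - \<beta>) - y)\<^sup>2 * jain_weight \<beta> k y)"
    by (rule sums_summable)
  have "(1 - \<beta>)\<^sup>2 * Q \<le> (1 - \<beta>)\<^sup>2 * ((y / (1 - \<beta>))\<^sup>2 + y / (1 - \<beta>) ^ 3)"
    unfolding Q_def by (intro mult_left_mono sq) auto
  also have "\<dots> = y\<^sup>2 + y / (1 - \<beta>)"
    using \<beta> by (simp add: distrib_left power_divide power2_eq_square power3_eq_cube)
  finally show "(\<Sum>k. (real k * (1 - \<beta>) - y)\<^sup>2 * jain_weight \<beta> k y) \<le> y / (1 - \<beta>)"
    using sums_unique[OF *] \<beta> by (simp add: power2_eq_square)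
qed

end

section \<open>Second differences and affine approximation\<close>

lemma fdiff_2: "(fdiff h ^^ 2) f x = f (x + 2 * h) - 2 * f (x + h) + f x"
  by (simp add: fdiff_def numeral_2_eq_2 algebra_simps)

text \<open>This crude bound makes the sets behind \<open>modulus\<close> bounded above, so that
  their suprema dominate the individual differences.\<close>

lemma abs_fdiff_power_le:
  assumes "\<And>x. 0 \<le> x \<Longrightarrow> \<bar>f x\<bar> \<le> B" "0 \<le> h" "0 \<le> x"
  shows "\<bar>(fdiff h ^^ m) f x\<bar> \<le> 2 ^ m * B"
  using \<open>0 \<le> x\<close>
proof (induction m arbitrary: x)
  case 0
  then show ?case using assms by simp
next
  case (Suc m)
  have "\<bar>(fdiff h ^^ m) f (x + h) - (fdiff h ^^ m) f x\<bar> \<le> 2 ^ m * B + 2 ^ m * B"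
    using Suc.IH[of x] Suc.IH[of "x + h"] Suc.prems \<open>0 \<le> h\<close> by linarith
  then show ?case by (simp add: fdiff_def [of h "(fdiff h ^^ m) f"] mult_ac)
qed

lemma abs_fdiff_power_le_modulus:
  assumes "f \<in> CB" "0 \<le> h" "h \<le> \<delta>" "0 \<le> x"
  shows "\<bar>(fdiff h ^^ m) f x\<bar> \<le> modulus m f \<delta>"
proof -
  obtain B where B: "\<And>x. 0 \<le> x \<Longrightarrow> \<bar>f x\<bar> \<le> B"
    using assms(1) by (auto simp: CB_def bounded_iff)
  have le: "\<bar>(fdiff h ^^ m) f x\<bar> \<le> 2 ^ m * B" if "0 \<le> h" "0 \<le> x" for h x
    using abs_fdiff_power_le[of f B] B that by blast
  have bdd: "bdd_above ((\<lambda>x. \<bar>(fdiff h ^^ m) f x\<bar>) ` {0..})" if "0 \<le> h" for h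
    using le that by (intro bdd_aboveI2[of _ _ "2 ^ m * B"]) auto
  have "\<bar>(fdiff h ^^ m) f x\<bar> \<le> (SUP x\<in>{0..}. \<bar>(fdiff h ^^ m) f x\<bar>)"
    using assms by (intro cSUP_upper bdd) auto
  also have "\<dots> \<le> modulus m f \<delta>"
    unfolding modulus_def
  proof (rule cSUP_upper)
    show "bdd_above ((\<lambda>h. SUP x\<in>{0..}. \<bar>(fdiff h ^^ m) f x\<bar>) ` {0..\<delta>})"
      using le by (intro bdd_aboveI2[of _ _ "2 ^ m * B"] cSUP_least) auto
  qed (use assms in auto)
  finally show ?thesis .
qed

lemma modulus_nonneg: "f \<in> CB \<Longrightarrow> 0 \<le> \<delta> \<Longrightarrow> 0 \<le> modulus m f \<delta>"
  using abs_fdiff_power_le_modulus[of f 0 \<delta> 0 m] by simp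

section \<open>Growth of functions with small second differences\<close>

text \<open>First differences start at no more than \<open>2 * w\<close> and grow by at most
  \<open>w\<close> per step; summing this linear growth gives a quadratic bound.\<close>

lemma second_difference_growth:
  fixes c :: "nat \<Rightarrow> real"
  assumes "\<bar>c 0\<bar> \<le> w" "\<bar>c 1\<bar> \<le> w"
    and "\<And>j. j + 2 \<le> J \<Longrightarrow> \<bar>c (j + 2) - 2 * c (j + 1) + c j\<bar> \<le> w"
  shows "\<bar>c J\<bar> \<le> (1 + real J)\<^sup>2 * w"
proof -
  have w: "0 \<le> w" using assms(1) by simp
  have d: "\<bar>c (Suc j) - c j\<bar> \<le> (2 + real j) * w" if "j + 1 \<le> J" for j
    using that
  proof (induction j)
    case 0
    then show ?case using assms(1,2) by simp
  next
    case (Suc j)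
    then show ?case using assms(3)[of j] by (simp add: algebra_simps)
  qed
  have "\<bar>c j\<bar> \<le> (1 + real j)\<^sup>2 * w" if "j \<le> J" for j
    using that
  proof (induction j)
    case 0
    then show ?case using assms(1) by simp
  next
    case (Suc j)
    have "\<bar>c (Suc j)\<bar> \<le> (1 + real j)\<^sup>2 * w + (2 + real j) * w"
      using Suc d[of j] by simp
    also have "\<dots> \<le> (1 + real (Suc j))\<^sup>2 * w"
      unfolding distrib_right [symmetric] using w
      by (intro mult_right_mono) (simp_all add: power2_eq_square algebra_simps)
    finally show ?case .
  qed
  then show ?thesis by simp
qed

text \<open>Reflecting at the endpoint nearer to \<open>t\<close> gives \<open>2 \<bar>f t\<bar> \<le> w + sup \<bar>f\<bar>\<close>.\<close>
lemma abs_le_of_second_difference: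
  fixes f :: "real \<Rightarrow> real"
  assumes h: "0 < h" and ends: "f a = 0" "f (a + 2 * h) = 0"
    and bdd: "\<And>t. t \<in> {a..a + 2 * h} \<Longrightarrow> \<bar>f t\<bar> \<le> B"
    and w: "\<And>u k. a \<le> u \<Longrightarrow> 0 \<le> k \<Longrightarrow> k \<le> h \<Longrightarrow> u + 2 * k \<le> a + 2 * h \<Longrightarrow>
        \<bar>f (u + 2 * k) - 2 * f (u + k) + f u\<bar> \<le> w"
    and t: "t \<in> {a..a + 2 * h}"
  shows "\<bar>f t\<bar> \<le> w"
proof -
  let ?I = "{a..a + 2 * h}"
  define M where "M = (SUP t\<in>?I. \<bar>f t\<bar>)"
  have ne: "?I \<noteq> {}" using h by simp
  have bd: "bdd_above ((\<lambda>t. \<bar>f t\<bar>) ` ?I)" using bdd by (intro bdd_aboveI2[of _ _ B]) auto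
  have M: "\<bar>f t\<bar> \<le> M" if "t \<in> ?I" for t
    unfolding M_def using that bd by (rule cSUP_upper)
  have half: "\<bar>f t\<bar> \<le> (w + M) / 2" if t: "t \<in> ?I" for t
  proof (cases "t \<le> a + h")
    case True
    have "\<bar>f (a + 2 * (t - a)) - 2 * f (a + (t - a)) + f a\<bar> \<le> w"
      using True t by (intro w) auto
    moreover have "\<bar>f (a + 2 * (t - a))\<bar> \<le> M" using True t by (intro M) auto
    ultimately show ?thesis using ends by (simp add: abs_le_iff) linarith
  next
    case False
    define k where "k = a + 2 * h - t"
    have "\<bar>f ((t - k) + 2 * k) - 2 * f ((t - k) + k) + f (t - k)\<bar> \<le> w"
      using False t by (intro w) (auto simp: k_def)
    moreover have "(t - k) + 2 * k = a + 2 * h" by (simp add: k_def)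
    moreover have "\<bar>f (t - k)\<bar> \<le> M" using False t by (intro M) (auto simp: k_def)
    ultimately show ?thesis using ends by (simp add: abs_le_iff) linarith
  qed
  \<comment> \<open>The values are bounded, so \<open>M\<close> is a genuine supremum, and half of
    it can be absorbed to give \<open>M \<le> w\<close>.\<close>
  have "M \<le> (w + M) / 2" unfolding M_def using ne half[unfolded M_def] by (rule cSUP_least)
  then show ?thesis using M[OF t] by simp
qed

text \<open>Subtracting an affine function leaves second differences unchanged. The remainder
  \<open>\<phi>\<close> vanishes at both ends of the chord, hence is at most \<open>w\<close>
  between them, and steps of length \<open>h\<close> carry this outward with quadratic
  growth.\<close>

lemma affine_approximation:
  assumes f: "f \<in> CB" and h: "0 < h" and x: "0 \<le> x"
  obtains p q where "\<And>t. 0 \<le> t \<Longrightarrow>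
    \<bar>f t - (p + q * t)\<bar> \<le> modulus 2 f h * (32 + 2 * ((t - x) / h)\<^sup>2)"
proof -
  define w where "w = modulus 2 f h"
  \<comment> \<open>The maximum keeps \<open>{a..a + 2 * h}\<close> in the half-line while it still
    contains \<open>x\<close>.\<close>
  define a where "a = max 0 (x - h)"
  define q where "q = (f (a + 2 * h) - f a) / (2 * h)"
  define p where "p = f a - q * a"
  define \<phi> where "\<phi> t = f t - (p + q * t)" for t
  have w0: "0 \<le> w" using f h by (simp add: w_def modulus_nonneg)
  have w: "\<bar>\<phi> (u + 2 * k) - 2 * \<phi> (u + k) + \<phi> u\<bar> \<le> w" if "0 \<le> u" "0 \<le> k" "k \<le> h" for u k
    using abs_fdiff_power_le_modulus[OF f that(2,3,1), of 2]
    by (simp add: \<phi>_def w_def fdiff_2 algebra_simps)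
  have a: "0 \<le> a" "x - h \<le> a" "a \<le> x" "a = 0 \<or> a = x - h" using x h by (auto simp: a_def)
  obtain B where B: "\<And>t. 0 \<le> t \<Longrightarrow> \<bar>f t\<bar> \<le> B"
    using f by (auto simp: CB_def bounded_iff)
  have near: "\<bar>\<phi> t\<bar> \<le> w" if "t \<in> {a..a + 2 * h}" for t
  proof (rule abs_le_of_second_difference [OF h, where f = \<phi> and a = a and t = t])
    show "\<phi> a = 0" "\<phi> (a + 2 * h) = 0" using h by (auto simp: \<phi>_def p_def q_def field_simps)
    show "\<bar>\<phi> t\<bar> \<le> B + (\<bar>p\<bar> + \<bar>q\<bar> * (a + 2 * h))" if "t \<in> {a..a + 2 * h}" for t
    proof -
      have "\<bar>\<phi> t\<bar> \<le> \<bar>f t\<bar> + (\<bar>p\<bar> + \<bar>q * t\<bar>)" unfolding \<phi>_def by linarith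
      also have "\<bar>q * t\<bar> \<le> \<bar>q\<bar> * (a + 2 * h)"
        unfolding abs_mult using that a by (intro mult_left_mono) auto
      finally show ?thesis using B[of t] that a by auto
    qed
  qed (use w that a in auto)
  \<comment> \<open>The allowance \<open>3 * h\<close> covers stepping in either direction. The
    constants come from \<open>(\<tau> + 4)\<^sup>2 + (\<tau> - 4)\<^sup>2 = 32 + 2 *
    \<tau>\<^sup>2\<close>.\<close>
  have far: "\<bar>\<phi> t\<bar> \<le> w * (32 + 2 * ((t - x) / h)\<^sup>2)"
    if j: "real j * h \<le> \<bar>t - x\<bar> + 3 * h" "\<bar>\<phi> t\<bar> \<le> (1 + real j)\<^sup>2 * w" for t j
  proof -
    define \<tau> where "\<tau> = \<bar>(t - x) / h\<bar>"
    have "real j \<le> \<tau> + 3" using j h by (simp add: \<tau>_def field_simps)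
    then have "(1 + real j)\<^sup>2 \<le> (\<tau> + 4)\<^sup>2" by (intro power_mono) auto
    also have "\<dots> \<le> 32 + 2 * \<tau>\<^sup>2"
      using zero_le_power2[of "\<tau> - 4"] by (simp add: power2_eq_square algebra_simps)
    also have "\<tau>\<^sup>2 = ((t - x) / h)\<^sup>2" by (simp only: \<tau>_def power2_abs)
    finally show ?thesis using j(2) w0
      by (metis order_trans mult.commute mult_left_mono)
  qed
  have "\<bar>\<phi> t\<bar> \<le> w * (32 + 2 * ((t - x) / h)\<^sup>2)" if t: "0 \<le> t" for t
  proof (cases "a \<le> t")
    case True
    \<comment> \<open>Steps to the left from \<open>t\<close> end at some \<open>s\<close> in
      \<open>{a..a + h}\<close>, so \<open>s\<close> and \<open>s + h\<close> both lie where
      \<open>near\<close> applies.\<close>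
    define j where "j = nat \<lfloor>(t - a) / h\<rfloor>"
    have j: "real j * h \<le> t - a" "t - a \<le> (real j + 1) * h"
      using True h by (simp_all add: j_def pos_le_divide_eq [symmetric] pos_divide_le_eq [symmetric])
    define s where "s = t - real j * h"
    have s: "a \<le> s" "s \<le> a + h" using j by (auto simp: s_def algebra_simps)
    have "\<bar>\<phi> (s + real j * h)\<bar> \<le> (1 + real j)\<^sup>2 * w"
    proof (rule second_difference_growth [where c = "\<lambda>j. \<phi> (s + real j * h)" and J = j])
      fix i
      have e: "s + real (i + 2) * h = (s + real i * h) + 2 * h"
          "s + real (i + 1) * h = (s + real i * h) + h" by (simp_all add: algebra_simps)
      show "\<bar>\<phi> (s + real (i + 2) * h) - 2 * \<phi> (s + real (i + 1) * h) + \<phi> (s + real i * h)\<bar> \<le> w"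
        unfolding e using s a h by (intro w) auto
    qed (use s h near in auto)
    then show ?thesis using j a by (intro far[of j]) (auto simp: s_def algebra_simps)
  next
    case False
    then have ax: "a = x - h" using a t by linarith
    \<comment> \<open>The additional step puts \<open>s\<close> into
      \<open>{a + h..a + 2 * h}\<close>, so \<open>near\<close> applies to \<open>s\<close> and
      \<open>s - h\<close>; the growth argument then runs down to \<open>t\<close>, never leaving
      the half-line.\<close>
    define j where "j = nat \<lceil>(a - t) / h\<rceil> + 1"
    have pos: "0 \<le> (a - t) / h" using False h by simp
    have "(a - t) / h \<le> real j - 1" "real j - 1 \<le> (a - t) / h + 1"
      unfolding j_def using pos by auto
    then have j: "a - t \<le> (real j - 1) * h" "(real j - 1) * h \<le> a - t + h"
      using h by (auto simp: field_simps)
    define s where "s = t + real j * h"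
    have s: "a + h \<le> s" "s \<le> a + 2 * h" using j by (auto simp: s_def algebra_simps)
    have "\<bar>\<phi> (s - real j * h)\<bar> \<le> (1 + real j)\<^sup>2 * w"
    proof (rule second_difference_growth [where c = "\<lambda>j. \<phi> (s - real j * h)" and J = j])
      fix i assume "i + 2 \<le> j"
      then have "real (i + 2) * h \<le> real j * h" using h by (intro mult_right_mono) auto
      then have i: "0 \<le> s - real (i + 2) * h" using t by (simp add: s_def)
      have e: "s - real i * h = (s - real (i + 2) * h) + 2 * h"
          "s - real (i + 1) * h = (s - real (i + 2) * h) + h" by (simp_all add: algebra_simps)
      show "\<bar>\<phi> (s - real (i + 2) * h) - 2 * \<phi> (s - real (i + 1) * h) + \<phi> (s - real i * h)\<bar> \<le> w"
        using w[OF i, of h] h unfolding e by (simp add: abs_le_iff)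
    qed (use s h near in auto)
    then show ?thesis using j ax h False by (intro far[of j]) (auto simp: s_def algebra_simps)
  qed
  then show thesis by (intro that[of p q]) (simp add: \<phi>_def w_def)
qed

section \<open>Moments of the kernels\<close>

text \<open>This is the upper incomplete gamma function \<open>\<Gamma>(j + 1, a)\<close>, the
  integral of \<open>s ^ j * exp (- s)\<close> from \<open>a\<close> to infinity; the recursion is
  integration by parts.\<close>

primrec upper_gamma :: "nat \<Rightarrow> real \<Rightarrow> real" where
  "upper_gamma 0 a = exp (- a)"
| "upper_gamma (Suc j) a = real (Suc j) * upper_gamma j a + a ^ Suc j * exp (- a)"

lemma upper_gamma_at_0: "upper_gamma j 0 = fact j"
  by (induction j) auto

lemma upper_gamma_nonneg: "0 \<le> a \<Longrightarrow> 0 \<le> upper_gamma j a"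
  by (induction j) auto

lemma upper_gamma_rec: "upper_gamma k a = real k * upper_gamma (k - 1) a + a ^ k * exp (- a)"
  by (cases k) auto

lemma DERIV_upper_gamma: "(upper_gamma j has_real_derivative - (x ^ j * exp (- x))) (at x)"
proof (induction j)
  case 0
  show ?case by (auto intro!: derivative_eq_intros)
next
  case (Suc j)
  have "((\<lambda>a. exp (- a)) has_real_derivative - exp (- x)) (at x)"
    by (auto intro!: derivative_eq_intros)
  then have "((\<lambda>a. real (Suc j) * upper_gamma j a + a ^ Suc j * exp (- a)) has_real_derivative
      real (Suc j) * (- (x ^ j * exp (- x)))
      + (real (Suc j) * x ^ (Suc j - Suc 0) * exp (- x) + - exp (- x) * x ^ Suc j)) (at x)"
    by (intro DERIV_add DERIV_cmult DERIV_mult DERIV_pow Suc.IH)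
  then show ?case by (simp add: mult.commute)
qed

lemma upper_gamma_tendsto_0: "(upper_gamma j \<longlongrightarrow> 0) at_top"
proof (induction j)
  case 0
  show ?case using tendsto_power_div_exp_0[of 0] by (simp add: exp_minus inverse_eq_divide)
next
  case (Suc j)
  have "((\<lambda>a. real (Suc j) * upper_gamma j a + a ^ Suc j / exp a) \<longlongrightarrow> real (Suc j) * 0 + 0) at_top"
    by (intro tendsto_intros Suc.IH tendsto_power_div_exp_0)
  then show ?case by (simp add: exp_minus divide_inverse)
qed

text \<open>\<open>- upper_gamma j\<close> is an antiderivative that vanishes at infinity, and the
  integrand is nonnegative on \<open>{a..}\<close>.\<close>

lemma has_integral_upper_gamma:
  assumes "0 \<le> a"
  shows "has_bochner_integral lborel (\<lambda>s. indicator {a..} s * (s ^ j * exp (- s))) (upper_gamma j a)"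
proof (rule has_bochner_integral_nn_integral)
  have "(\<integral>\<^sup>+s. ennreal (s ^ j * exp (- s)) * indicator {a..} s \<partial>lborel) = 0 - (- upper_gamma j a)"
  proof (rule nn_integral_FTC_atLeast)
    show "((\<lambda>a. - upper_gamma j a) \<longlongrightarrow> 0) at_top"
      using tendsto_minus[OF upper_gamma_tendsto_0[of j]] by simp
    show "((\<lambda>a. - upper_gamma j a) has_real_derivative x ^ j * exp (- x)) (at x)" for x
      using DERIV_minus[OF DERIV_upper_gamma[of j x]] by simp
  qed (use assms in auto)
  also have "(\<integral>\<^sup>+s. ennreal (s ^ j * exp (- s)) * indicator {a..} s \<partial>lborel)
      = (\<integral>\<^sup>+s. ennreal (indicator {a..} s * (s ^ j * exp (- s))) \<partial>lborel)"
    by (intro nn_integral_cong) (auto split: split_indicator)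
  finally show "(\<integral>\<^sup>+s. ennreal (indicator {a..} s * (s ^ j * exp (- s))) \<partial>lborel) = ennreal (upper_gamma j a)"
    by simp
qed (use assms in \<open>auto simp: upper_gamma_nonneg split: split_indicator\<close>)

lemma has_bochner_integral_le:
  fixes f g :: "'a \<Rightarrow> real"
  assumes "has_bochner_integral M f x" "has_bochner_integral M g y" "\<And>t. f t \<le> g t"
  shows "x \<le> y"
  using integral_mono[of M f g] assms by (auto simp: has_bochner_integral_iff)

section \<open>Mass, mean and second moment of the basis functions\<close>

context
  fixes \<beta> :: real and n :: nat
  assumes \<beta>: "0 < \<beta>" "\<beta> < 1" and n: "0 < n"
begin

lemma phillips_basis_nonneg: "0 \<le> t \<Longrightarrow> 0 \<le> phillips_basis \<beta> n k t"
  using \<beta> by (simp add: phillips_basis_eq jain_weight_nonneg)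

text \<open>The right-hand side also covers \<open>k = 0\<close>, where the term with the truncated exponent
  \<open>k - 1\<close> has the factor \<open>0\<close>.\<close>
lemma phillips_basis_eq_gamma:
  "phillips_basis \<beta> n k t =
     ((real n * t + real k * \<beta>) ^ k - real k * \<beta> * (real n * t + real k * \<beta>) ^ (k - 1))
       * exp (- (real n * t + real k * \<beta>)) / fact k"
  by (cases k) (auto simp: phillips_basis_def algebra_simps)

text \<open>The substitution \<open>s = n * t + k * \<beta>\<close> maps the half-line to
  \<open>{k * \<beta>..}\<close>. The factor \<open>F\<close> lets one substitution serve all
  moments.\<close>

lemma has_integral_phillips_basis:
  assumes "has_bochner_integral lborel (\<lambda>s. indicator {real k * \<beta>..} s *
             (F s * ((s ^ k - real k * \<beta> * s ^ (k - 1)) * exp (- s)))) I"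
  shows "has_bochner_integral lborel (\<lambda>t. indicator {0..} t *
             (phillips_basis \<beta> n k t * F (real n * t + real k * \<beta>))) (I / (fact k * real n))"
proof -
  have ind: "indicator {real k * \<beta>..} (real k * \<beta> + real n * t) = (indicator {0..} t :: real)" for t
    using n by (auto split: split_indicator simp: zero_le_mult_iff)
  have "has_bochner_integral lborel (\<lambda>t. indicator {0..} t *
      (F (real k * \<beta> + real n * t) * (((real k * \<beta> + real n * t) ^ k
        - real k * \<beta> * (real k * \<beta> + real n * t) ^ (k - 1)) * exp (- (real k * \<beta> + real n * t)))))
      (I /\<^sub>R \<bar>real n\<bar>)"
    using assms n by (subst (asm) lborel_has_bochner_integral_real_affine_iff[of "real n" _ _ "real k * \<beta>"])
      (simp_all add: ind)
  then have "has_bochner_integral lborel (\<lambda>t. indicator {0..} t *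
      (F (real k * \<beta> + real n * t) * (((real k * \<beta> + real n * t) ^ k
        - real k * \<beta> * (real k * \<beta> + real n * t) ^ (k - 1)) * exp (- (real k * \<beta> + real n * t)))) / fact k)
      (I /\<^sub>R \<bar>real n\<bar> / fact k)"
    by (rule has_bochner_integral_divide_zero)
  then show ?thesis
    by (simp add: phillips_basis_eq_gamma add.commute divide_inverse mult_ac)
qed

context
  fixes k :: nat and a G e :: real
  defines "a \<equiv> real k * \<beta>" and "G \<equiv> real k * upper_gamma (k - 1) (real k * \<beta>)"
    and "e \<equiv> (real k * \<beta>) ^ k * exp (- (real k * \<beta>))"
begin

text \<open>\<open>G\<close> and \<open>e\<close> are the two terms of integration by parts for
  \<open>upper_gamma k a\<close>; the mass and first moment become linear in them. In the last
  relation the factor \<open>a\<close> vanishes for \<open>k = 0\<close>, where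
  \<open>s ^ (k - 1) * s\<close> need not be \<open>s ^ k\<close>.\<close>

lemma upper_gamma_relations:
  "0 \<le> a" "0 \<le> G" "0 \<le> e" "upper_gamma k a = G + e" "a * upper_gamma (k - 1) a = \<beta> * G"
  "upper_gamma (Suc k) a = (real k + 1) * (G + e) + a * e" "a * s ^ (k - 1) * s = a * s ^ k"
proof -
  show 1: "0 \<le> a" "0 \<le> e" using \<beta> by (simp_all add: a_def e_def)
  show "0 \<le> G" using \<beta> by (simp add: G_def upper_gamma_nonneg)
  show 2: "upper_gamma k a = G + e" unfolding a_def G_def e_def by (rule upper_gamma_rec)
  show "a * upper_gamma (k - 1) a = \<beta> * G" by (simp add: a_def G_def)
  show "upper_gamma (Suc k) a = (real k + 1) * (G + e) + a * e"
    unfolding upper_gamma.simps 2 by (simp add: a_def e_def)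
  show "a * s ^ (k - 1) * s = a * s ^ k" by (cases k) (simp_all add: a_def)
qed

lemma has_integral_phillips_basis_1:
  "has_bochner_integral lborel (\<lambda>t. indicator {0..} t * phillips_basis \<beta> n k t)
     (((1 - \<beta>) * G + e) / (fact k * real n))"
proof -
  have "has_bochner_integral lborel (\<lambda>s. indicator {a..} s * (s ^ k * exp (- s))
      - a * (indicator {a..} s * (s ^ (k - 1) * exp (- s)))) (upper_gamma k a - a * upper_gamma (k - 1) a)"
    by (intro has_bochner_integral_diff has_bochner_integral_mult_right has_integral_upper_gamma upper_gamma_relations)
  then show ?thesis
    unfolding upper_gamma_relations
    using has_integral_phillips_basis[of k "\<lambda>_. 1" "(1 - \<beta>) * G + e"]
    by (simp add: a_def algebra_simps)
qed

lemma has_integral_phillips_basis_t: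
  "has_bochner_integral lborel (\<lambda>t. indicator {0..} t * (phillips_basis \<beta> n k t * (real n * t)))
     (((real k + 1) * (G + e) + a * e - 2 * a * (G + e) + a * \<beta> * G) / (fact k * real n))"
proof -
  have "has_bochner_integral lborel (\<lambda>s. indicator {a..} s * (s ^ Suc k * exp (- s))
      - 2 * a * (indicator {a..} s * (s ^ k * exp (- s)))
      + a * (a * (indicator {a..} s * (s ^ (k - 1) * exp (- s)))))
      (upper_gamma (Suc k) a - 2 * a * upper_gamma k a + a * (a * upper_gamma (k - 1) a))"
    by (intro has_bochner_integral_diff has_bochner_integral_add has_bochner_integral_mult_right
        has_integral_upper_gamma upper_gamma_relations)
  also have "(\<lambda>s. indicator {a..} s * (s ^ Suc k * exp (- s))
      - 2 * a * (indicator {a..} s * (s ^ k * exp (- s)))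
      + a * (a * (indicator {a..} s * (s ^ (k - 1) * exp (- s)))))
      = (\<lambda>s. indicator {a..} s * ((s - a) * ((s ^ k - a * s ^ (k - 1)) * exp (- s))))"
  proof
    fix s :: real
    have "(s - a) * (s ^ k - a * s ^ (k - 1)) = s ^ Suc k - 2 * a * s ^ k + a * (a * s ^ (k - 1))"
      using upper_gamma_relations(7)[of s] by (auto simp: left_diff_distrib right_diff_distrib mult_ac)
    then have "(s - a) * ((s ^ k - a * s ^ (k - 1)) * exp (- s))
      = (s ^ Suc k - 2 * a * s ^ k + a * (a * s ^ (k - 1))) * exp (- s)"
      by (simp only: mult.assoc [symmetric])
    then show "indicator {a..} s * (s ^ Suc k * exp (- s))
      - 2 * a * (indicator {a..} s * (s ^ k * exp (- s)))
      + a * (a * (indicator {a..} s * (s ^ (k - 1) * exp (- s))))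
      = indicator {a..} s * ((s - a) * ((s ^ k - a * s ^ (k - 1)) * exp (- s)))"
      by (auto simp: algebra_simps)
  qed
  also have "upper_gamma (Suc k) a - 2 * a * upper_gamma k a + a * (a * upper_gamma (k - 1) a)
      = (real k + 1) * (G + e) + a * e - 2 * a * (G + e) + a * \<beta> * G"
    unfolding upper_gamma_relations by simp
  finally show ?thesis
    using has_integral_phillips_basis[of k "\<lambda>s. s - real k * \<beta>"]
    unfolding a_def by (simp only: add_diff_cancel_right')
qed

text \<open>For \<open>k > 0\<close> the integrand \<open>(s - a) * s ^ (k - 1) * exp (- s)\<close>
  is nonpositive on \<open>[0, a)\<close>, so extending the integral down to \<open>0\<close> cannot
  increase it. The extended integral is \<open>(1 - \<beta>) * fact k\<close>.\<close>

lemma phillips_basis_mass_ge: "(1 - \<beta>) * fact k \<le> (1 - \<beta>) * G + e"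
proof (cases k)
  case 0
  then show ?thesis using \<beta> by (simp add: G_def e_def)
next
  case (Suc j)
  have int: "has_bochner_integral lborel (\<lambda>s. indicator {b..} s * (s ^ k * exp (- s))
      - a * (indicator {b..} s * (s ^ j * exp (- s)))) (upper_gamma k b - a * upper_gamma j b)"
    if "0 \<le> b" for b
    by (intro has_bochner_integral_diff has_bochner_integral_mult_right has_integral_upper_gamma that)
  have "upper_gamma k 0 - a * upper_gamma j 0 \<le> upper_gamma k a - a * upper_gamma j a"
  proof (rule has_bochner_integral_le [OF int int])
    fix s :: real
    have "s ^ k * exp (- s) - a * (s ^ j * exp (- s)) = (s - a) * (s ^ j * exp (- s))"
      by (simp add: Suc algebra_simps)
    moreover have "(s - a) * (s ^ j * exp (- s)) \<le> 0" if "0 \<le> s" "s < a"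
      using that by (intro mult_nonpos_nonneg) auto
    ultimately show "indicator {0..} s * (s ^ k * exp (- s)) - a * (indicator {0..} s * (s ^ j * exp (- s)))
        \<le> indicator {a..} s * (s ^ k * exp (- s)) - a * (indicator {a..} s * (s ^ j * exp (- s)))"
      using upper_gamma_relations(1) by (cases "a \<le> s"; cases "0 \<le> s") auto
  qed (use upper_gamma_relations in auto)
  also have "upper_gamma k a - a * upper_gamma j a = (1 - \<beta>) * G + e"
    using upper_gamma_relations(4,5) Suc by (simp add: algebra_simps)
  also have "upper_gamma k 0 - a * upper_gamma j 0 = (1 - \<beta>) * fact k"
    unfolding upper_gamma_at_0 a_def Suc by (simp add: algebra_simps)
  finally show ?thesis .
qed

text \<open>The excess of \<open>N\<close> over the lower bound is exactly
  \<open>\<beta> * (2 - \<beta>) * G + \<beta> * e\<close>. Comparing it with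
  \<open>(1 - \<beta>) * G + e\<close> yields the constant of \<open>phillips_shift\<close>.\<close>

lemma phillips_basis_mean_bounds:
  defines "N \<equiv> (real k + 1) * (G + e) + a * e - 2 * a * (G + e) + a * \<beta> * G"
  shows "(real k + 1) * (1 - \<beta>) * ((1 - \<beta>) * G + e) \<le> N"
    and "N \<le> ((real k + 1) * (1 - \<beta>) + \<beta> * (2 - \<beta>) / (1 - \<beta>)) * ((1 - \<beta>) * G + e)"
proof -
  have 1: "N - (real k + 1) * (1 - \<beta>) * ((1 - \<beta>) * G + e) = \<beta> * (2 - \<beta>) * G + \<beta> * e"
    unfolding N_def a_def by algebra
  moreover have "0 \<le> \<beta> * (2 - \<beta>) * G" "0 \<le> \<beta> * e" using upper_gamma_relations \<beta> by auto
  ultimately show "(real k + 1) * (1 - \<beta>) * ((1 - \<beta>) * G + e) \<le> N" by linarith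
  have "\<beta> * e \<le> \<beta> * (2 - \<beta>) / (1 - \<beta>) * e"
    using \<beta> upper_gamma_relations by (intro mult_right_mono) (auto simp: field_simps)
  moreover have "\<beta> * (2 - \<beta>) / (1 - \<beta>) * ((1 - \<beta>) * G + e)
      = \<beta> * (2 - \<beta>) * G + \<beta> * (2 - \<beta>) / (1 - \<beta>) * e"
    using \<beta> by (simp add: distrib_left)
  ultimately show "N \<le> ((real k + 1) * (1 - \<beta>) + \<beta> * (2 - \<beta>) / (1 - \<beta>)) * ((1 - \<beta>) * G + e)"
    unfolding distrib_right[of "(real k + 1) * (1 - \<beta>)"] using 1 by linarith
qed

text \<open>Dropping the negative term and extending the integral to \<open>{0..}\<close> only
  increases it. What remains is a complete gamma integral, equal to
  \<open>fact k * (k + 1 + \<beta>\<^sup>2)\<close>.\<close>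

lemma phillips_basis_second_moment:
  obtains I where
    "has_bochner_integral lborel (\<lambda>t. indicator {0..} t *
       (phillips_basis \<beta> n k t * (real n * t - (real k + 1) * (1 - \<beta>))\<^sup>2)) I"
    "I \<le> 2 * (real k + 1) / real n"
proof -
  \<comment> \<open>This is the centre \<open>(k + 1) * (1 - \<beta>)\<close> moved by
    \<open>k * \<beta>\<close>, as the substitution requires.\<close>
  define c where "c = real k + 1 - \<beta>"
  define J where "J = upper_gamma (k + 2) a - 2 * c * upper_gamma (k + 1) a + c\<^sup>2 * upper_gamma k a
    - a * (upper_gamma (k - 1 + 2) a - 2 * c * upper_gamma (k - 1 + 1) a + c\<^sup>2 * upper_gamma (k - 1) a)"
  have sq: "has_bochner_integral lborel (\<lambda>s. indicator {b..} s * ((s - c)\<^sup>2 * (s ^ j * exp (- s))))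
    (upper_gamma (j + 2) b - 2 * c * upper_gamma (j + 1) b + c\<^sup>2 * upper_gamma j b)" if "0 \<le> b" for j b
  proof -
    have "has_bochner_integral lborel (\<lambda>s. indicator {b..} s * (s ^ (j + 2) * exp (- s))
        - 2 * c * (indicator {b..} s * (s ^ (j + 1) * exp (- s)))
        + c\<^sup>2 * (indicator {b..} s * (s ^ j * exp (- s))))
      (upper_gamma (j + 2) b - 2 * c * upper_gamma (j + 1) b + c\<^sup>2 * upper_gamma j b)"
      by (intro has_bochner_integral_diff has_bochner_integral_add has_bochner_integral_mult_right
          has_integral_upper_gamma that)
    then show ?thesis by (simp add: power2_eq_square algebra_simps)
  qed
  have J: "has_bochner_integral lborel (\<lambda>s. indicator {a..} s *
      ((s - c)\<^sup>2 * ((s ^ k - a * s ^ (k - 1)) * exp (- s)))) J"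
  proof -
    have "has_bochner_integral lborel (\<lambda>s. indicator {a..} s * ((s - c)\<^sup>2 * (s ^ k * exp (- s)))
        - a * (indicator {a..} s * ((s - c)\<^sup>2 * (s ^ (k - 1) * exp (- s))))) J"
      unfolding J_def by (intro has_bochner_integral_diff has_bochner_integral_mult_right sq upper_gamma_relations)
    then show ?thesis by (simp add: algebra_simps)
  qed
  have "J \<le> upper_gamma (k + 2) 0 - 2 * c * upper_gamma (k + 1) 0 + c\<^sup>2 * upper_gamma k 0"
  proof (rule has_bochner_integral_le [OF J sq])
    fix s :: real
    have "(s - c)\<^sup>2 * ((s ^ k - a * s ^ (k - 1)) * exp (- s)) \<le> (s - c)\<^sup>2 * (s ^ k * exp (- s))" if "a \<le> s"
      using upper_gamma_relations(1) that by (intro mult_left_mono mult_right_mono) auto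
    then show "indicator {a..} s * ((s - c)\<^sup>2 * ((s ^ k - a * s ^ (k - 1)) * exp (- s)))
        \<le> indicator {0..} s * ((s - c)\<^sup>2 * (s ^ k * exp (- s)))"
      using upper_gamma_relations(1) by (auto split: split_indicator)
  qed simp
  also have "\<dots> = fact k * (real k + 1 + \<beta>\<^sup>2)"
    by (simp add: upper_gamma_at_0 c_def power2_eq_square algebra_simps)
  also have "\<dots> \<le> fact k * (2 * (real k + 1))"
    using \<beta> power_le_one[of \<beta> 2] by (intro mult_left_mono) auto
  finally have "J / (fact k * real n) \<le> fact k * (2 * (real k + 1)) / (fact k * real n)"
    by (rule divide_right_mono) simp
  then have "J / (fact k * real n) \<le> 2 * (real k + 1) / real n" by simp
  moreover have "has_bochner_integral lborel (\<lambda>t. indicator {0..} t *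
      (phillips_basis \<beta> n k t * (real n * t - (real k + 1) * (1 - \<beta>))\<^sup>2)) (J / (fact k * real n))"
  proof -
    have e: "real n * t - (real k + 1) * (1 - \<beta>) = real n * t + real k * \<beta> - c" for t
      by (simp add: c_def algebra_simps)
    show ?thesis unfolding e
      using has_integral_phillips_basis[of k "\<lambda>s. (s - c)\<^sup>2", OF J[unfolded a_def]] .
  qed
  ultimately show thesis by (intro that)
qed

end

end

section \<open>Averages against the normalized kernels\<close>

definition phillips_coeff :: "real \<Rightarrow> nat \<Rightarrow> nat \<Rightarrow> (real \<Rightarrow> real) \<Rightarrow> real" where
  "phillips_coeff \<beta> n k f = pairing (phillips_basis \<beta> n k) f / pairing (phillips_basis \<beta> n k) (\<lambda>_. 1)"

context
  fixes \<beta> :: real and n :: nat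
  assumes \<beta>: "0 < \<beta>" "\<beta> < 1" and n: "0 < n"
begin

lemma pairing_phillips_basis:
  "has_bochner_integral lborel (\<lambda>t. indicator {0..} t * (phillips_basis \<beta> n k t * f t)) I
     \<Longrightarrow> pairing (phillips_basis \<beta> n k) f = I"
  by (simp add: pairing_def set_lebesgue_integral_def has_bochner_integral_iff)

lemma integrable_phillips_basis: "integrable lborel (\<lambda>t. indicator {0..} t * phillips_basis \<beta> n k t)"
  using has_integral_phillips_basis_1[OF \<beta> n] by (rule integrable.intros)

lemma phillips_basis_mass:
  "has_bochner_integral lborel (\<lambda>t. indicator {0..} t * phillips_basis \<beta> n k t)
     (pairing (phillips_basis \<beta> n k) (\<lambda>_. 1))"
  "(1 - \<beta>) / real n \<le> pairing (phillips_basis \<beta> n k) (\<lambda>_. 1)"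
proof -
  note i = has_integral_phillips_basis_1[OF \<beta> n, of k]
  have e: "pairing (phillips_basis \<beta> n k) (\<lambda>_. 1) =
    ((1 - \<beta>) * (real k * upper_gamma (k - 1) (real k * \<beta>))
      + (real k * \<beta>) ^ k * exp (- (real k * \<beta>))) / (fact k * real n)"
    by (rule pairing_phillips_basis) (use i in simp)
  show "has_bochner_integral lborel (\<lambda>t. indicator {0..} t * phillips_basis \<beta> n k t)
     (pairing (phillips_basis \<beta> n k) (\<lambda>_. 1))" unfolding e by (rule i)
  have "(1 - \<beta>) / real n = (1 - \<beta>) * fact k / (fact k * real n)" by simp
  also have "\<dots> \<le> pairing (phillips_basis \<beta> n k) (\<lambda>_. 1)"
    unfolding e by (intro divide_right_mono phillips_basis_mass_ge [OF \<beta> n]) simp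
  finally show "(1 - \<beta>) / real n \<le> pairing (phillips_basis \<beta> n k) (\<lambda>_. 1)" .
qed

lemma phillips_basis_mass_pos: "0 < pairing (phillips_basis \<beta> n k) (\<lambda>_. 1)"
  by (rule less_le_trans [OF _ phillips_basis_mass(2)]) (use \<beta> n in simp)

lemma phillips_basis_mean:
  fixes k :: nat
  defines "c \<equiv> (real k + 1) * (1 - \<beta>)"
  shows "has_bochner_integral lborel (\<lambda>t. indicator {0..} t * (phillips_basis \<beta> n k t * t))
     (pairing (phillips_basis \<beta> n k) (\<lambda>t. t))"
    and "c / real n \<le> phillips_coeff \<beta> n k (\<lambda>t. t)"
    and "phillips_coeff \<beta> n k (\<lambda>t. t) \<le> (c + \<beta> * (2 - \<beta>) / (1 - \<beta>)) / real n"
proof -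
  define a G e where "a = real k * \<beta>" and "G = real k * upper_gamma (k - 1) (real k * \<beta>)"
    and "e = (real k * \<beta>) ^ k * exp (- (real k * \<beta>))"
  note defs = a_def G_def e_def
  define N where "N = (real k + 1) * (G + e) + a * e - 2 * a * (G + e) + a * \<beta> * G"
  define D where "D = (1 - \<beta>) * G + e"
  have "has_bochner_integral lborel
      (\<lambda>t. indicator {0..} t * (phillips_basis \<beta> n k t * (real n * t)) / real n) (N / (fact k * real n) / real n)"
    unfolding N_def defs by (intro has_bochner_integral_divide_zero has_integral_phillips_basis_t \<beta> n)
  then have i: "has_bochner_integral lborel (\<lambda>t. indicator {0..} t * (phillips_basis \<beta> n k t * t))
      (N / (fact k * real n) / real n)"
    using n by simp
  note eN = pairing_phillips_basis[OF i]
  show "has_bochner_integral lborel (\<lambda>t. indicator {0..} t * (phillips_basis \<beta> n k t * t))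
     (pairing (phillips_basis \<beta> n k) (\<lambda>t. t))" unfolding eN by (rule i)
  have eD: "pairing (phillips_basis \<beta> n k) (\<lambda>_. 1) = D / (fact k * real n)"
    unfolding D_def defs by (rule pairing_phillips_basis) (use has_integral_phillips_basis_1[OF \<beta> n, of k] in simp)
  have D: "0 < D" using phillips_basis_mass_pos[of k] n mult_nonneg_nonneg[of "fact k" "real n"] unfolding eD
    by (auto simp: zero_less_divide_iff simp del: mult_nonneg_nonneg)
  have q: "phillips_coeff \<beta> n k (\<lambda>t. t) = N / D / real n"
    unfolding phillips_coeff_def eN eD using n D by simp
  have "c * D \<le> N" "N \<le> (c + \<beta> * (2 - \<beta>) / (1 - \<beta>)) * D"
    unfolding c_def N_def D_def defs by (rule phillips_basis_mean_bounds [OF \<beta> n])+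
  then have "c \<le> N / D" "N / D \<le> c + \<beta> * (2 - \<beta>) / (1 - \<beta>)"
    using D by (simp_all add: pos_le_divide_eq pos_divide_le_eq)
  then show "c / real n \<le> phillips_coeff \<beta> n k (\<lambda>t. t)"
     "phillips_coeff \<beta> n k (\<lambda>t. t) \<le> (c + \<beta> * (2 - \<beta>) / (1 - \<beta>)) / real n"
    unfolding q by (intro divide_right_mono; simp)+
qed

lemma integrable_phillips_basis_mult:
  assumes "f \<in> CB"
  shows "integrable lborel (\<lambda>t. indicator {0..} t * (phillips_basis \<beta> n k t * f t))"
proof -
  obtain B where B: "\<And>x. 0 \<le> x \<Longrightarrow> \<bar>f x\<bar> \<le> B"
    using assms by (auto simp: CB_def bounded_iff)
  have [measurable]: "(\<lambda>t. indicator {0..} t * f t) \<in> borel_measurable borel"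
    using borel_measurable_continuous_on_indicator[of "{0..}" f] assms by (simp add: CB_def)
  have m [measurable]: "(\<lambda>t. indicator {0..} t * phillips_basis \<beta> n k t) \<in> borel_measurable borel"
    using borel_measurable_integrable[OF integrable_phillips_basis] by simp
  \<comment> \<open>Continuity of \<open>f\<close> is known only on \<open>{0..}\<close>;
    duplicating the indicator makes both factors measurable on the whole line.\<close>
  have e: "indicator {0..} t * (phillips_basis \<beta> n k t * f t)
      = (indicator {0..} t * phillips_basis \<beta> n k t) * (indicator {0..} t * f t)" for t
    by (simp split: split_indicator)
  show ?thesis
  proof (rule Bochner_Integration.integrable_bound
      [where f = "\<lambda>t. B * (indicator {0..} t * phillips_basis \<beta> n k t)"])
    show "integrable lborel (\<lambda>t. B * (indicator {0..} t * phillips_basis \<beta> n k t))"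
      by (intro integrable_mult_right integrable_phillips_basis)
    show "(\<lambda>t. indicator {0..} t * (phillips_basis \<beta> n k t * f t)) \<in> borel_measurable lborel"
      unfolding e by simp
    show "AE t in lborel. norm (indicator {0..} t * (phillips_basis \<beta> n k t * f t))
        \<le> norm (B * (indicator {0..} t * phillips_basis \<beta> n k t))"
    proof (rule AE_I2)
      fix t :: real
      have "\<bar>phillips_basis \<beta> n k t\<bar> * \<bar>f t\<bar> \<le> \<bar>phillips_basis \<beta> n k t\<bar> * \<bar>B\<bar>" if "0 \<le> t"
        using B[OF that] by (intro mult_left_mono) auto
      then show "norm (indicator {0..} t * (phillips_basis \<beta> n k t * f t))
        \<le> norm (B * (indicator {0..} t * phillips_basis \<beta> n k t))"
        by (auto split: split_indicator simp: abs_mult mult.commute)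
    qed
  qed
qed

text \<open>Averaging sends an affine function to its value at the kernel mean, so the pointwise
  bound can be integrated. The square about \<open>x\<close> is split at the approximate centre
  \<open>c / n\<close>, at the cost of a factor \<open>2\<close>.\<close>

lemma phillips_coeff_affine_bound:
  fixes k :: nat and x :: real
  assumes f: "f \<in> CB" and w: "0 \<le> A" "0 \<le> B"
    and le: "\<And>t. 0 \<le> t \<Longrightarrow> \<bar>f t - (p + q * t)\<bar> \<le> A + B * (t - x)\<^sup>2"
  defines "c \<equiv> (real k + 1) * (1 - \<beta>)"
  shows "\<bar>phillips_coeff \<beta> n k f - (p + q * phillips_coeff \<beta> n k (\<lambda>t. t))\<bar>
    \<le> A + B * (4 * (real k + 1) / ((real n)\<^sup>2 * (1 - \<beta>)) + 2 * ((c - real n * x) / real n)\<^sup>2)"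
proof -
  define L where "L t = indicator {0..} t * phillips_basis \<beta> n k t" for t :: real
  define D where "D = pairing (phillips_basis \<beta> n k) (\<lambda>_. 1)"
  define m where "m = pairing (phillips_basis \<beta> n k) (\<lambda>t. t)"
  define F where "F = pairing (phillips_basis \<beta> n k) f"
  define d where "d = 2 * ((c - real n * x) / real n)\<^sup>2"
  have D: "0 < D" "(1 - \<beta>) / real n \<le> D"
    unfolding D_def by (rule phillips_basis_mass_pos phillips_basis_mass)+
  have L0: "0 \<le> L t" for t
    using phillips_basis_nonneg[OF \<beta> n] by (simp add: L_def split: split_indicator)
  have iL: "has_bochner_integral lborel L D"
    unfolding L_def D_def by (rule phillips_basis_mass)
  have im: "has_bochner_integral lborel (\<lambda>t. L t * t) m"
    using phillips_basis_mean(1)[of k] by (simp add: L_def m_def mult.assoc)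
  have iF: "has_bochner_integral lborel (\<lambda>t. L t * f t) F"
    using integrable_phillips_basis_mult[OF f, of k]
    by (simp add: L_def F_def mult.assoc has_bochner_integral_iff pairing_def set_lebesgue_integral_def)
  obtain I where iI: "has_bochner_integral lborel (\<lambda>t. L t * (real n * t - c)\<^sup>2) I"
    and I: "I \<le> 2 * (real k + 1) / real n"
    using phillips_basis_second_moment[OF \<beta> n, of k] by (auto simp: L_def c_def mult.assoc)
  have diff: "has_bochner_integral lborel (\<lambda>t. L t * f t - (p * L t + q * (L t * t))) (F - (p * D + q * m))"
    by (intro has_bochner_integral_diff has_bochner_integral_add has_bochner_integral_mult_right iL im iF)
  have bnd: "has_bochner_integral lborel
      (\<lambda>t. (A + B * d) * L t + (B * (2 / (real n)\<^sup>2)) * (L t * (real n * t - c)\<^sup>2))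
      ((A + B * d) * D + (B * (2 / (real n)\<^sup>2)) * I)"
    by (intro has_bochner_integral_add has_bochner_integral_mult_right iL iI)
  have pt: "\<bar>L t * f t - (p * L t + q * (L t * t))\<bar>
      \<le> (A + B * d) * L t + (B * (2 / (real n)\<^sup>2)) * (L t * (real n * t - c)\<^sup>2)" for t
  proof (cases "0 \<le> t")
    case True
    have "t - x = (real n * t - c) / real n + (c - real n * x) / real n"
      using n by (simp add: field_simps)
    then have "(t - x)\<^sup>2 = ((real n * t - c) / real n + (c - real n * x) / real n)\<^sup>2" by simp
    also have "\<dots> \<le> 2 * ((real n * t - c) / real n)\<^sup>2 + d"
      unfolding d_def using sum_squares_bound[of "(real n * t - c) / real n" "(c - real n * x) / real n"]
      by (simp add: power2_sum)
    finally have "A + B * (t - x)\<^sup>2 \<le> A + B * (2 * ((real n * t - c) / real n)\<^sup>2 + d)"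
      using w by (intro add_left_mono mult_left_mono)
    then have "\<bar>f t - (p + q * t)\<bar> \<le> (A + B * d) + (B * (2 / (real n)\<^sup>2)) * (real n * t - c)\<^sup>2"
      using le[OF True] by (simp add: power_divide algebra_simps)
    then have "L t * \<bar>f t - (p + q * t)\<bar>
        \<le> L t * ((A + B * d) + (B * (2 / (real n)\<^sup>2)) * (real n * t - c)\<^sup>2)"
      using L0 by (rule mult_left_mono)
    moreover have "L t * f t - (p * L t + q * (L t * t)) = L t * (f t - (p + q * t))"
      by (simp add: algebra_simps)
    ultimately have "\<bar>L t * f t - (p * L t + q * (L t * t))\<bar>
        \<le> L t * ((A + B * d) + (B * (2 / (real n)\<^sup>2)) * (real n * t - c)\<^sup>2)"
      using L0[of t] by (simp only: abs_mult abs_of_nonneg)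
    then show ?thesis by (simp add: distrib_left mult_ac)
  qed (simp add: L_def)
  have "\<bar>F - (p * D + q * m)\<bar> \<le> (A + B * d) * D + (B * (2 / (real n)\<^sup>2)) * I"
  proof -
    have "F - (p * D + q * m) \<le> (A + B * d) * D + (B * (2 / (real n)\<^sup>2)) * I"
      by (rule has_bochner_integral_le [OF diff bnd]) (use pt in \<open>auto simp: abs_le_iff\<close>)
    moreover have "- (F - (p * D + q * m)) \<le> (A + B * d) * D + (B * (2 / (real n)\<^sup>2)) * I"
      by (rule has_bochner_integral_le [OF has_bochner_integral_minus [OF diff] bnd])
        (use pt in \<open>auto simp: abs_le_iff\<close>)
    ultimately show ?thesis by (simp add: abs_le_iff)
  qed
  \<comment> \<open>The lower bound on the mass \<open>D\<close> turns the unnormalized second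
    moment into a multiple of \<open>D\<close>, which cancels in the quotient.\<close>
  also have "(B * (2 / (real n)\<^sup>2)) * I \<le> (B * (2 / (real n)\<^sup>2)) * (2 * (real k + 1) / (1 - \<beta>) * D)"
  proof (intro mult_left_mono)
    have "2 * (real k + 1) / real n = 2 * (real k + 1) / (1 - \<beta>) * ((1 - \<beta>) / real n)"
      using \<beta> by simp
    also have "\<dots> \<le> 2 * (real k + 1) / (1 - \<beta>) * D"
      using \<beta> D by (intro mult_left_mono) auto
    finally show "I \<le> 2 * (real k + 1) / (1 - \<beta>) * D" using I by simp
  qed (use w in auto)
  finally have "\<bar>F - (p * D + q * m)\<bar>
      \<le> (A + B * d) * D + B * (2 / (real n)\<^sup>2) * (2 * (real k + 1) / (1 - \<beta>) * D)"
    by simp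
  also have "\<dots> = (A + B * (4 * (real k + 1) / ((real n)\<^sup>2 * (1 - \<beta>)) + d)) * D"
    using \<beta> n by (simp add: field_simps)
  finally have "\<bar>F - (p * D + q * m)\<bar>
      \<le> (A + B * (4 * (real k + 1) / ((real n)\<^sup>2 * (1 - \<beta>)) + d)) * D" .
  moreover have "\<bar>F / D - (p + q * (m / D))\<bar> = \<bar>F - (p * D + q * m)\<bar> / D"
  proof -
    have "F / D - (p + q * (m / D)) = (F - (p * D + q * m)) / D" using D by (simp add: field_simps)
    then show ?thesis using D by simp
  qed
  ultimately have "\<bar>F / D - (p + q * (m / D))\<bar>
      \<le> A + B * (4 * (real k + 1) / ((real n)\<^sup>2 * (1 - \<beta>)) + d)"
    using D by (simp add: pos_divide_le_eq)
  then show ?thesis by (simp add: phillips_coeff_def F_def D_def m_def d_def)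
qed

end

section \<open>The estimate\<close>

lemma sums_Suc_shift:
  fixes f :: "nat \<Rightarrow> real"
  shows "f sums s \<Longrightarrow> (\<lambda>k. f (Suc k)) sums (s - f 0)"
  by (simp add: sums_Suc_iff)

text \<open>The terms linear in \<open>x\<close> collapse to
  \<open>2 * r * (1 + \<beta> * (2 - \<beta>) * E)\<close>. For \<open>x > 0\<close> the result
  makes \<open>phillips_delta\<close> positive and at least the square of the shift.\<close>

lemma phillips_shift_le_delta:
  assumes "0 < \<beta>" "\<beta> < 1" "0 < n" "0 \<le> x"
  shows "2 * x / (real n * (1 - \<beta>)) + (phillips_shift \<beta> n x)\<^sup>2 \<le> phillips_delta \<beta> n x"
proof -
  define E where "E = exp (- (real n * x))"
  have E: "0 \<le> E" "E \<le> 1" using assms by (auto simp: E_def)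
  define r where "r = x / (real n * (1 - \<beta>))"
  have r: "0 \<le> r" using assms by (simp add: r_def)
  have "phillips_delta \<beta> n x = 2 * r + 2 * (\<beta> * (2 - \<beta>)) * r * E
     + (1 - E) * (\<beta>\<^sup>2 * (3 - \<beta>) / ((real n)\<^sup>2 * (1 - \<beta>))) + (phillips_shift \<beta> n x)\<^sup>2"
    unfolding phillips_delta_def E_def [symmetric]
    by (simp add: r_def divide_inverse power2_eq_square algebra_simps)
  moreover have "0 \<le> 2 * (\<beta> * (2 - \<beta>)) * r * E" "0 \<le> (1 - E) * (\<beta>\<^sup>2 * (3 - \<beta>) / ((real n)\<^sup>2 * (1 - \<beta>)))"
    using assms E r by auto
  ultimately show ?thesis by (simp add: r_def)
qed

text \<open>The triangle inequality leads from the operator to \<open>p + q * \<mu>\<close>, then to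
  \<open>f \<mu>\<close>, then to \<open>f x\<close>. The first two steps cost
  \<open>32 + 6 / (1 - \<beta>)\<close> and \<open>34\<close> times the second modulus, the last the
  first modulus. Positivity of \<open>x\<close> gives \<open>h > 0\<close>.\<close>

lemma phillips_op_estimate:
  fixes x :: real
  assumes \<beta>: "0 < \<beta>" "\<beta> < 1" and n: "0 < n" and x: "0 < x" and f: "f \<in> CB"
  shows "\<bar>phillips_op \<beta> n f x - f x\<bar>
     \<le> (66 + 6 / (1 - \<beta>)) * modulus 2 f (sqrt (phillips_delta \<beta> n x)) + modulus 1 f (phillips_shift \<beta> n x)"
proof -
  define \<delta> where "\<delta> = phillips_delta \<beta> n x"
  define h where "h = sqrt \<delta>"
  define w where "w = modulus 2 f h"
  define s where "s = phillips_shift \<beta> n x"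
  define E where "E = exp (- (real n * x))"
  \<comment> \<open>The index is shifted: the missing weight of index \<open>0\<close> is
    \<open>E\<close>, the mass of the atom at the point \<open>0\<close>.\<close>
  define u where "u k = phillips_basis \<beta> n (Suc k) x" for k
  define m where "m k = phillips_coeff \<beta> n k (\<lambda>t. t)" for k
  define c where "c k = (real k + 1) * (1 - \<beta>)" for k
  define y where "y = real n * x"
  have y: "0 \<le> y" using x by (simp add: y_def)
  have u_eq: "u k = jain_weight \<beta> (Suc k) y" for k
    by (simp add: u_def y_def phillips_basis_eq)
  have E: "0 \<le> E" "E \<le> 1" using x by (auto simp: E_def)
  have u0: "0 \<le> u k" for k using \<beta> y by (simp add: u_eq jain_weight_nonneg)
  have s0: "0 \<le> s" using \<beta> E by (simp add: s_def phillips_shift_def E_def)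
  have \<delta>: "2 * x / (real n * (1 - \<beta>)) + s\<^sup>2 \<le> \<delta>"
    unfolding \<delta>_def s_def using phillips_shift_le_delta[OF \<beta> n] x by simp
  have r: "0 < 2 * x / (real n * (1 - \<beta>))" using x n \<beta> by simp
  then have \<delta>0: "0 < \<delta>" "s\<^sup>2 \<le> \<delta>" "2 * x / (real n * (1 - \<beta>)) \<le> \<delta>"
    using \<delta> zero_le_power2[of s] by linarith+
  have h: "0 < h" "h\<^sup>2 = \<delta>" using \<delta>0 by (auto simp: h_def)
  have w0: "0 \<le> w" unfolding w_def by (rule modulus_nonneg) (use f h in auto)
  obtain p q where pq: "\<And>t. 0 \<le> t \<Longrightarrow> \<bar>f t - (p + q * t)\<bar> \<le> w * (32 + 2 * ((t - x) / h)\<^sup>2)"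
    unfolding w_def by (rule affine_approximation[OF f h(1) less_imp_le[OF x]]) blast

  have sum_u: "(\<lambda>k. u k) sums (1 - E)"
    using sums_Suc_shift[OF jain_weight_sums[OF \<beta> y]] unfolding u_eq by (simp add: E_def y_def)
  have sum_k: "(\<lambda>k. (real k + 1) * u k) sums (y / (1 - \<beta>))"
    using sums_Suc_shift[OF jain_weight_mean_sums[OF \<beta> y]] by (simp add: u_eq add.commute)
  have sum_c: "(\<lambda>k. c k * u k) sums y"
    using sums_mult[OF sum_k, of "1 - \<beta>"] \<beta> by (simp add: c_def mult_ac)
  define Q where "Q = (\<Sum>k. (real k * (1 - \<beta>) - y)\<^sup>2 * jain_weight \<beta> k y)"
  have Q: "Q \<le> y / (1 - \<beta>)" unfolding Q_def by (rule jain_weight_variance[OF \<beta> y])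
  \<comment> \<open>\<open>Q\<close> includes the index \<open>0\<close>, whose term
    \<open>y\<^sup>2 * E\<close> is removed here.\<close>
  have sum_sq: "(\<lambda>k. (c k - y)\<^sup>2 * u k) sums (Q - y\<^sup>2 * E)"
    using sums_Suc_shift[OF summable_sums[OF jain_weight_variance(1)[OF \<beta> y]]]
    by (simp add: u_eq c_def Q_def E_def y_def add.commute)

  have m: "c k / real n \<le> m k" "m k \<le> (c k + \<beta> * (2 - \<beta>) / (1 - \<beta>)) / real n" for k
    unfolding m_def c_def by (rule phillips_basis_mean[OF \<beta> n])+
  have low: "(\<lambda>k. c k / real n * u k) sums x"
    using sums_divide[OF sum_c, of "real n"] n by (simp add: y_def)
  have up: "(\<lambda>k. (c k + \<beta> * (2 - \<beta>) / (1 - \<beta>)) / real n * u k) sums (x + s)"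
  proof -
    have "(\<lambda>k. c k / real n * u k + \<beta> * (2 - \<beta>) / (1 - \<beta>) / real n * u k) sums
        (x + \<beta> * (2 - \<beta>) / (1 - \<beta>) / real n * (1 - E))"
      by (intro sums_add low sums_mult sum_u)
    moreover have "\<beta> * (2 - \<beta>) / (1 - \<beta>) / real n * (1 - E) = s"
      by (simp add: s_def phillips_shift_def E_def mult.commute)
    ultimately show ?thesis
      by (simp only: distrib_right [symmetric] add_divide_distrib [symmetric])
  qed
  \<comment> \<open>The atom at \<open>0\<close> adds nothing to the first moment, so
    \<open>\<mu>\<close> is the mean of the whole measure.\<close>
  define \<mu> where "\<mu> = (\<Sum>k. m k * u k)"
  have c0: "0 \<le> c k" for k using \<beta> by (simp add: c_def)
  have "summable (\<lambda>k. m k * u k)"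
  proof (rule summable_comparison_test' [OF sums_summable[OF up]])
    fix k
    have "0 \<le> m k" using m(1)[of k] c0[of k] by (meson divide_nonneg_nonneg of_nat_0_le_iff order_trans)
    then show "norm (m k * u k) \<le> (c k + \<beta> * (2 - \<beta>) / (1 - \<beta>)) / real n * u k"
      using mult_right_mono[OF m(2)[of k] u0[of k]] u0[of k] by (simp add: abs_mult)
  qed
  then have sum_m: "(\<lambda>k. m k * u k) sums \<mu>" unfolding \<mu>_def by (rule summable_sums)
  have \<mu>: "x \<le> \<mu>" "\<mu> \<le> x + s"
    by (rule sums_le [OF _ low sum_m] sums_le [OF _ sum_m up]; intro mult_right_mono m u0)+

  define V where "V k = 4 * (real k + 1) / ((real n)\<^sup>2 * (1 - \<beta>)) + 2 * ((c k - y) / real n)\<^sup>2" for k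
  define A where "A = 32 * w"
  define B where "B = 2 * w / \<delta>"
  have AB: "0 \<le> A" "0 \<le> B" using w0 \<delta>0 by (auto simp: A_def B_def)
  have AB_eq: "w * (32 + 2 * ((t - x) / h)\<^sup>2) = A + B * (t - x)\<^sup>2" for t
    by (simp add: A_def B_def power_divide h(2) algebra_simps)
  define g where "g k = (phillips_coeff \<beta> n k f - (p + q * m k)) * u k" for k
  have g_le: "\<bar>g k\<bar> \<le> (A + B * V k) * u k" for k
    unfolding g_def abs_mult abs_of_nonneg[OF u0] V_def y_def m_def c_def
    by (intro mult_right_mono phillips_coeff_affine_bound \<beta> n f AB u0) (use pq AB_eq in auto)
  define S where "S = 4 * (y / (1 - \<beta>)) / ((real n)\<^sup>2 * (1 - \<beta>)) + 2 * (Q - y\<^sup>2 * E) / (real n)\<^sup>2"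
  have "(\<lambda>k. 4 / ((real n)\<^sup>2 * (1 - \<beta>)) * ((real k + 1) * u k) + 2 / (real n)\<^sup>2 * ((c k - y)\<^sup>2 * u k)) sums
      (4 / ((real n)\<^sup>2 * (1 - \<beta>)) * (y / (1 - \<beta>)) + 2 / (real n)\<^sup>2 * (Q - y\<^sup>2 * E))"
    by (intro sums_add sums_mult sum_k sum_sq)
  moreover have "V k * u k = 4 / ((real n)\<^sup>2 * (1 - \<beta>)) * ((real k + 1) * u k)
      + 2 / (real n)\<^sup>2 * ((c k - y)\<^sup>2 * u k)" for k
    by (simp add: V_def distrib_right power_divide mult.assoc)
  moreover have "S = 4 / ((real n)\<^sup>2 * (1 - \<beta>)) * (y / (1 - \<beta>)) + 2 / (real n)\<^sup>2 * (Q - y\<^sup>2 * E)"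
    by (simp add: S_def)
  ultimately have sum_V: "(\<lambda>k. V k * u k) sums S" by (simp only:)
  have "(\<lambda>k. A * u k + B * (V k * u k)) sums (A * (1 - E) + B * S)"
    by (intro sums_add sums_mult sum_u sum_V)
  then have sum_AB: "(\<lambda>k. (A + B * V k) * u k) sums (A * (1 - E) + B * S)"
    by (simp add: distrib_right mult.assoc)
  have g_summable: "summable g"
    by (rule summable_comparison_test' [OF sums_summable[OF sum_AB]]) (use g_le in simp)
  have g_sum: "\<bar>suminf g\<bar> \<le> A * (1 - E) + B * S"
  proof -
    have "suminf g \<le> A * (1 - E) + B * S"
      by (rule sums_le [OF _ summable_sums[OF g_summable] sum_AB]) (use g_le in \<open>auto simp: abs_le_iff\<close>)
    moreover have "- suminf g \<le> A * (1 - E) + B * S"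
      by (rule sums_le [OF _ sums_minus[OF summable_sums[OF g_summable]] sum_AB])
        (use g_le in \<open>auto simp: abs_le_iff\<close>)
    ultimately show ?thesis by (simp add: abs_le_iff)
  qed
  have "(\<lambda>k. g k + (p * u k + q * (m k * u k))) sums (suminf g + (p * (1 - E) + q * \<mu>))"
    by (intro sums_add sums_mult summable_sums g_summable sum_u sum_m)
  then have "(\<lambda>k. phillips_coeff \<beta> n k f * u k) sums (suminf g + (p * (1 - E) + q * \<mu>))"
    by (simp add: g_def algebra_simps)
  then have op: "phillips_op \<beta> n f x = suminf g + (p * (1 - E) + q * \<mu>) + E * f 0"
    unfolding phillips_op_def phillips_coeff_def u_def E_def by (simp add: sums_iff)
  \<comment> \<open>The atom lies at squared distance \<open>x\<^sup>2\<close> from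
    \<open>x\<close>.\<close>
  have z: "\<bar>f 0 - p\<bar> \<le> A + B * x\<^sup>2" using pq[of 0] unfolding AB_eq by simp
  have "\<bar>phillips_op \<beta> n f x - (p + q * \<mu>)\<bar> = \<bar>suminf g + E * (f 0 - p)\<bar>"
    unfolding op by (simp add: algebra_simps)
  also have "\<dots> \<le> \<bar>suminf g\<bar> + E * \<bar>f 0 - p\<bar>"
    using abs_triangle_ineq[of "suminf g" "E * (f 0 - p)"] E by (simp add: abs_mult)
  also have "\<dots> \<le> (A * (1 - E) + B * S) + E * (A + B * x\<^sup>2)"
    using g_sum z E by (intro add_mono mult_left_mono)
  also have "\<dots> = A + B * (S + E * x\<^sup>2)" by (simp add: algebra_simps)
  \<comment> \<open>The term \<open>- 2 * E * x\<^sup>2\<close> inside \<open>S\<close> outweighs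
    the atom's \<open>E * x\<^sup>2\<close>. The rest is at most
    \<open>6 * x / (n * (1 - \<beta>)\<^sup>2)\<close>, to which the lower bound for
    \<open>\<delta>\<close> applies.\<close>
  also have "S + E * x\<^sup>2 \<le> 3 * \<delta> / (1 - \<beta>)"
  proof -
    have "S + E * x\<^sup>2 = 4 * (y / (1 - \<beta>)) / ((real n)\<^sup>2 * (1 - \<beta>)) + 2 * Q / (real n)\<^sup>2 - E * x\<^sup>2"
      using n by (simp add: S_def y_def diff_divide_distrib right_diff_distrib power_mult_distrib)
    also have "\<dots> \<le> 4 * (y / (1 - \<beta>)) / ((real n)\<^sup>2 * (1 - \<beta>)) + 2 * (y / (1 - \<beta>) / (1 - \<beta>)) / (real n)\<^sup>2"
    proof -
      have "y / (1 - \<beta>) * 1 \<le> y / (1 - \<beta>) * (1 / (1 - \<beta>))"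
        using \<beta> y by (intro mult_left_mono) auto
      then have "2 * Q / (real n)\<^sup>2 \<le> 2 * (y / (1 - \<beta>) / (1 - \<beta>)) / (real n)\<^sup>2"
        using Q by (intro divide_right_mono) auto
      moreover have "0 \<le> E * x\<^sup>2" using E by simp
      ultimately show ?thesis by linarith
    qed
    also have "\<dots> = 3 * (2 * x / (real n * (1 - \<beta>))) / (1 - \<beta>)"
      using n by (simp add: y_def power2_eq_square)
    also have "\<dots> \<le> 3 * \<delta> / (1 - \<beta>)"
      using \<delta>0 \<beta> by (intro divide_right_mono mult_left_mono) auto
    finally show ?thesis .
  qed
  also have "A + B * (3 * \<delta> / (1 - \<beta>)) = w * (32 + 6 / (1 - \<beta>))"
    using \<delta>0 by (simp add: A_def B_def algebra_simps)
  finally have 1: "\<bar>phillips_op \<beta> n f x - (p + q * \<mu>)\<bar> \<le> w * (32 + 6 / (1 - \<beta>))"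
    using AB by (simp add: mult_left_mono)
  have "\<bar>f \<mu> - (p + q * \<mu>)\<bar> \<le> w * (32 + 2 * ((\<mu> - x) / h)\<^sup>2)"
    using \<mu> x by (intro pq) auto
  \<comment> \<open>The mean is within \<open>s \<le> h\<close> of \<open>x\<close>, so the
    quadratic term is at most \<open>2\<close>.\<close>
  also have "\<dots> \<le> w * (32 + 2 * 1)"
  proof (intro mult_left_mono add_left_mono w0)
    have "(\<mu> - x)\<^sup>2 \<le> s\<^sup>2" using \<mu> by (intro power_mono) auto
    also have "\<dots> \<le> h\<^sup>2" using \<delta>0 h by simp
    finally show "((\<mu> - x) / h)\<^sup>2 \<le> 1" using h(1) by (simp add: power_divide)
  qed auto
  finally have 2: "\<bar>f \<mu> - (p + q * \<mu>)\<bar> \<le> w * 34" by simp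
  have 3: "\<bar>f \<mu> - f x\<bar> \<le> modulus 1 f s"
    using abs_fdiff_power_le_modulus[OF f, of "\<mu> - x" s x 1] \<mu> x by (simp add: fdiff_def)
  have "\<bar>phillips_op \<beta> n f x - f x\<bar> \<le> w * (32 + 6 / (1 - \<beta>)) + w * 34 + modulus 1 f s"
    using 1 2 3 by linarith
  also have "\<dots> = (66 + 6 / (1 - \<beta>)) * w + modulus 1 f s" by (simp add: algebra_simps)
  finally show ?thesis by (simp add: w_def h_def \<delta>_def s_def)
qed

theorem theorem2:
  fixes \<beta> :: real
  assumes "0 < \<beta>" and "\<beta> < 1"
  shows "\<exists>C>0. \<forall>f\<in>CB. \<forall>n::nat. n > 0 \<longrightarrow> (\<forall>x\<ge>0.
           \<bar>phillips_op \<beta> n f x - f x\<bar>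
             \<le> C * modulus 2 f (sqrt (phillips_delta \<beta> n x))
                + modulus 1 f (phillips_shift \<beta> n x))"
proof (intro exI conjI ballI allI impI)
  show "0 < 66 + 6 / (1 - \<beta>)" using assms by (simp add: add_pos_pos)
  fix f and n :: nat and x :: real
  assume f: "f \<in> CB" and n: "0 < n" and x: "0 \<le> x"
  show "\<bar>phillips_op \<beta> n f x - f x\<bar> \<le> (66 + 6 / (1 - \<beta>)) * modulus 2 f (sqrt (phillips_delta \<beta> n x))
      + modulus 1 f (phillips_shift \<beta> n x)"
  \<comment> \<open>At \<open>x = 0\<close> the quantity \<open>phillips_delta\<close> vanishes and
    gives no positive step \<open>h\<close>, but the operator reproduces \<open>f 0\<close>
    exactly.\<close>
  proof (cases "x = 0")
    case True
    have "phillips_op \<beta> n f x = f x" by (simp add: True phillips_op_def phillips_basis_def)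
    moreover have "0 \<le> modulus 2 f (sqrt (phillips_delta \<beta> n x))" "0 \<le> modulus 1 f (phillips_shift \<beta> n x)"
      by (auto intro!: modulus_nonneg f simp: True phillips_delta_def phillips_shift_def)
    ultimately show ?thesis using assms by simp
  next
    case False
    then show ?thesis using x by (intro phillips_op_estimate [OF assms n _ f]) simp
  qed
qed

end
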